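(* Let $n\in\mathbb{N}$ and let $\mu,\eta\in\mathbb{C}$ with $|\mu|=|\eta|=1$. Let $\phi$ be an analytic self-map of $\mathbb{D}$ and let $\psi$ be an analytic function on $\mathbb{D}$ such that $D_{n,\psi,\phi}$ is bounded on $\mathcal{S}^2_1(\mathbb{D})$. For $b\in\mathbb{C}$ put $$F_1(z)=\sum_{k=n}^{\infty}\frac{k!}{(k-n)!}\delta_k(\eta b)^{k-n}z^k,\qquad F_2(z)=\sum_{k=n+1}^{\infty}\frac{k!}{(k-n-1)!}\delta_k(\eta b)^{k-n-1}z^k,$$ where $\delta_k=\frac{2}{(k+1)(k+2)}$. Consider, for $a,b,c\in\mathbb{C}$, the condition $$(\ast)\qquad \psi(z)=\frac{a}{n!\,\delta_n}F_1(z)\quad\text{and}\quad\phi(z)=b+c\,\frac{n+3}{(n+1)^2}\cdot\frac{F_2(z)}{F_1(z)}\quad\text{for all } z\in\mathbb{D}.$$ (i) If $D_{n,\psi,\phi}$ is complex symmetric on $\mathcal{S}^2_1(\mathbb{D})$ with conjugation $C_{\mu,\eta}$, then there exist $a,b,c\in\mathbb{C}$ such that $(\ast)$ holds. (ii) Conversely, if $\psi$ and $\phi$ are given by $(\ast)$ for some $a,b,c\in\mathbb{C}$, then $D_{n,\psi,\phi}$ is complex symmetric on $\mathcal{S}^2_1(\mathbb{D})$ with conjugation $C_{\mu,\eta}$ only if $b=0$ or $c=0$ or both are zero.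
   Context: $\mathbb{D}=\{z\in\mathbb{C}:|z|<1\}$ and $\mathbb{N}=\{1,2,3,\dots\}$. The derivative Hardy space $\mathcal{S}^2_1(\mathbb{D})$ is the Hilbert space of analytic functions $f(z)=\sum_{m\ge0}f_mz^m$ on $\mathbb{D}$ with $\|f\|^2_{\mathcal{S}^2_1}=\sum_{m=0}^{\infty}\frac{(m+1)(m+2)}{2}|f_m|^2<\infty$, with the corresponding inner product $\langle f,g\rangle=\sum_{m=0}^\infty\frac{(m+1)(m+2)}{2}f_m\overline{g_m}$. (Equivalently, $\|f\|^2_{\mathcal{S}^2_1}=\|f\|^2_{\mathcal{H}^2}+\frac32\|f'\|^2_{\mathcal{A}^2}+\frac12\|f'\|^2_{\mathcal{H}^2}$, with $\mathcal{H}^2$ the Hardy space and $\mathcal{A}^2$ the unweighted Bergman space with normalized area measure.) The weighted composition-differentiation operator is $(D_{n,\psi,\phi}f)(z)=\psi(z)f^{(n)}(\phi(z))$, where $f^{(n)}$ is the $n$-th derivative. "Bounded on $\mathcal{S}^2_1(\mathbb{D})$" means that it defines a bounded linear operator from $\mathcal{S}^2_1(\mathbb{D})$ to itself. The conjugation $C_{\mu,\eta}$ is the antilinear map $(C_{\mu,\eta}f)(z)=\mu\,\overline{f(\overline{\eta z})}$. A bounded operator $T$ is complex symmetric with conjugation $C_{\mu,\eta}$ if $T=C_{\mu,\eta}T^*C_{\mu,\eta}$. Convention: $(\ast)$ includes convergence of the series involved on $\mathbb{D}$, and $F_2/F_1$ is understood as an analytic function on $\mathbb{D}$ with removable singularities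 filled in. In particular, $F_1$ and $F_2$ vanish at $0$ to orders $n$ and $n+1$ respectively, so $F_2/F_1$ takes the value $0$ at $z=0$. Also $0^0=1$ in the series when $b=0$.
   Formalization: The formal theorem additionally assumes that ψ is not identically zero on the disc; for ψ = 0 the operator is zero and trivially complex symmetric, so (i) fails for φ(z)=z² and (ii) fails for a=0 with small nonzero b, c. *)

theory Defs
  imports "HOL-Complex_Analysis.Complex_Analysis"
begin

abbreviation unit_disc :: "complex set" where
  "unit_disc \<equiv> ball 0 1"

section \<open>The derivative Hardy space\<close>

definition taylor_coeff :: "(complex \<Rightarrow> complex) \<Rightarrow> nat \<Rightarrow> complex" where
  "taylor_coeff f m = (deriv ^^ m) f 0 / fact m"

definition S21_weight :: "nat \<Rightarrow> real" where
  "S21_weight m = (real m + 1) * (real m + 2) / 2"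

text \<open>
  Functions on the disc are represented by total functions that are \<open>0\<close> outside the disc, so that
  equality of elements of the space is HOL equality.
\<close>

definition S21 :: "(complex \<Rightarrow> complex) set" where
  "S21 = {f. f holomorphic_on unit_disc \<and> (\<forall>z. z \<notin> unit_disc \<longrightarrow> f z = 0) \<and>
             summable (\<lambda>m. S21_weight m * (cmod (taylor_coeff f m))\<^sup>2)}"

definition S21_inner :: "(complex \<Rightarrow> complex) \<Rightarrow> (complex \<Rightarrow> complex) \<Rightarrow> complex" where
  "S21_inner f g =
     (\<Sum>m. of_real (S21_weight m) * taylor_coeff f m * cnj (taylor_coeff g m))"

definition S21_norm :: "(complex \<Rightarrow> complex) \<Rightarrow> real" where
  "S21_norm f = sqrt (\<Sum>m. S21_weight m * (cmod (taylor_coeff f m))\<^sup>2)"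

section \<open>Operators\<close>

type_synonym operator = "(complex \<Rightarrow> complex) \<Rightarrow> (complex \<Rightarrow> complex)"

definition S21_bounded :: "operator \<Rightarrow> bool" where
  "S21_bounded T \<longleftrightarrow>
     (\<forall>f\<in>S21. T f \<in> S21) \<and>
     (\<forall>f\<in>S21. \<forall>g\<in>S21. T (\<lambda>z. f z + g z) = (\<lambda>z. T f z + T g z)) \<and>
     (\<forall>f\<in>S21. \<forall>\<alpha>. T (\<lambda>z. \<alpha> * f z) = (\<lambda>z. \<alpha> * T f z)) \<and>
     (\<exists>K. \<forall>f\<in>S21. S21_norm (T f) \<le> K * S21_norm f)"

text \<open>For bounded \<open>T\<close> and \<open>g \<in> S21\<close>, the element described here exists by the Riesz
  representation theorem, and it is unique.\<close>

definition S21_adjoint :: "operator \<Rightarrow> operator" where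
  "S21_adjoint T g = (THE h. h \<in> S21 \<and> (\<forall>f\<in>S21. S21_inner (T f) g = S21_inner f h))"

definition comp_diff :: "nat \<Rightarrow> (complex \<Rightarrow> complex) \<Rightarrow> (complex \<Rightarrow> complex) \<Rightarrow> operator" where
  "comp_diff n \<psi> \<phi> f = (\<lambda>z. if z \<in> unit_disc then \<psi> z * (deriv ^^ n) f (\<phi> z) else 0)"

definition conjugation :: "complex \<Rightarrow> complex \<Rightarrow> operator" where
  "conjugation \<mu> \<eta> f = (\<lambda>z. \<mu> * cnj (f (cnj (\<eta> * z))))"

definition complex_symmetric :: "operator \<Rightarrow> operator \<Rightarrow> bool" where
  "complex_symmetric T C \<longleftrightarrow> (\<forall>f\<in>S21. T f = C (S21_adjoint T (C f)))"

section \<open>The series and the representation of the symbols\<close>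

definition delta :: "nat \<Rightarrow> complex" where
  "delta k = 2 / ((of_nat k + 1) * (of_nat k + 2))"

text \<open>
  \<open>F_term p \<beta> k z\<close> is the \<open>k\<close>-th term, \<open>k \<ge> p\<close>, of the series with lower limit \<open>p\<close>. With
  \<open>\<beta> = \<eta> b\<close>, \<open>p = n\<close> gives \<open>F\<^sub>1\<close> and \<open>p = n + 1\<close> gives \<open>F\<^sub>2\<close>.
\<close>

definition F_term :: "nat \<Rightarrow> complex \<Rightarrow> nat \<Rightarrow> complex \<Rightarrow> complex" where
  "F_term p \<beta> k z = fact k / fact (k - p) * delta k * \<beta> ^ (k - p) * z ^ k"

definition F_series :: "nat \<Rightarrow> complex \<Rightarrow> complex \<Rightarrow> complex" where
  "F_series p \<beta> z = (\<Sum>j. F_term p \<beta> (j + p) z)"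

text \<open>
  \<open>remove_sings\<close> fills in the removable singularities, in particular the one at \<open>0\<close>, where the
  division in HOL would give \<open>0 / 0\<close>.
\<close>

definition F_ratio :: "nat \<Rightarrow> complex \<Rightarrow> complex \<Rightarrow> complex" where
  "F_ratio n \<beta> = remove_sings (\<lambda>z. F_series (n + 1) \<beta> z / F_series n \<beta> z)"

definition symbol_condition ::
  "nat \<Rightarrow> complex \<Rightarrow> (complex \<Rightarrow> complex) \<Rightarrow> (complex \<Rightarrow> complex) \<Rightarrow>
   complex \<Rightarrow> complex \<Rightarrow> complex \<Rightarrow> bool" where
  "symbol_condition n \<eta> \<psi> \<phi> a b c \<longleftrightarrow>
     (\<forall>z\<in>unit_disc. summable (\<lambda>j. F_term n (\<eta> * b) (j + n) z) \<and>
                    summable (\<lambda>j. F_term (n + 1) (\<eta> * b) (j + (n + 1)) z)) \<and>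
     F_ratio n (\<eta> * b) holomorphic_on unit_disc \<and>
     (\<forall>z\<in>unit_disc.
        \<psi> z = a / (fact n * delta n) * F_series n (\<eta> * b) z \<and>
        \<phi> z = b + c * ((of_nat n + 3) / (of_nat n + 1)\<^sup>2) * F_ratio n (\<eta> * b) z)"

end

theory Submission
  imports Defs "HOL-Real_Asymp.Real_Asymp"
begin

text \<open>
  For \<open>C = C\<^sub>\<mu>\<^sub>,\<^sub>\<eta>\<close> the pairing \<open>(f, g) \<mapsto> \<langle>f, C g\<rangle>\<close> is bilinear and diagonal on the monomials
  \<open>z\<^sup>k\<close>, and \<open>T = C T\<^sup>* C\<close> says that \<open>T\<close> is symmetric for it. If \<open>A k j\<close> is the coefficient of
  \<open>z\<^sup>k\<close> in \<open>T z\<^sup>j\<close>, this reads \<open>\<eta>\<^sup>j \<delta>\<^sub>j A k j = \<eta>\<^sup>k \<delta>\<^sub>k A j k\<close> (\<open>complex_symmetric_entries\<close>). To get it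
  from the definition one has to know that \<open>T\<^sup>*\<close> exists, which is the Riesz representation theorem
  \<open>S21_riesz_representation\<close>.

  For \<open>T = D\<^sub>n\<^sub>,\<^sub>\<psi>\<^sub>,\<^sub>\<phi>\<close> the column \<open>j \<ge> n\<close> consists of the Taylor coefficients of
  \<open>j! / (j - n)! \<psi> \<phi>\<^bsup>j - n\<^esup>\<close>, and \<open>\<psi>\<close> vanishes at \<open>0\<close> to order \<open>n\<close>. Hence row \<open>n\<close> involves only
  \<open>a = \<psi>\<^sub>n\<close> and \<open>b = \<phi>(0)\<close>, and row \<open>n + 1\<close> only \<open>c = \<phi>'(0)\<close> and \<open>\<psi>\<^sub>n\<^sub>+\<^sub>1\<close> in addition. Equating row \<open>n\<close>
  with column \<open>n\<close>, which is \<open>n! \<psi>\<close>, yields \<open>\<psi>\<close> as a multiple of \<open>F\<^sub>1\<close> (\<open>Psi_formula\<close>). Equating row \<open>n + 1\<close>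
  with column \<open>n + 1\<close>, which is \<open>(n + 1)! \<psi> \<phi>\<close>, yields \<open>\<psi> (\<phi> - b)\<close> as a multiple of \<open>F\<^sub>2\<close>
  (\<open>Psi_h_formula\<close>). Dividing one by the other gives the form of \<open>\<phi>\<close>.

  The symmetry of the two entries at \<open>n + 2\<close> and \<open>n + 3\<close> is a further condition on \<open>a, b, c\<close>.
  With \<open>r\<^sub>j = (j + n + 1)\<^sup>2 / (j + n + 3)\<close>, which governs the quotients of consecutive coefficients of \<open>F\<^sub>1\<close>,
  it becomes \<open>a b c\<^sup>2 (2 r\<^sub>1 - r\<^sub>0 - r\<^sub>2) = 0\<close>. As \<open>r\<^sub>0, r\<^sub>1, r\<^sub>2\<close> are not in arithmetic progression,
  \<open>a b c = 0\<close> (\<open>product_zero\<close>), and \<open>a \<noteq> 0\<close> because \<open>\<psi>\<close> is not identically \<open>0\<close>.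

  It remains to see that \<open>F\<^sub>2 / F\<^sub>1\<close> is analytic on the disc. When \<open>c = 0\<close> the function \<open>\<phi>\<close> is constant and
  gives no information on this quotient, so the zeros of \<open>F\<^sub>1\<close> have to be located. Up to a constant, \<open>F\<^sub>1(z)\<close> is
  \<open>z\<^sup>n\<close> times the hypergeometric series \<open>\<^sub>2F\<^sub>1(n + 1, n + 1; n + 3; w)\<close> at \<open>w = \<eta> b z\<close>. By Euler's transformation
  this series equals \<open>(1 - w)\<^bsup>1 - n\<^esup> \<^sub>2F\<^sub>1(2, 2; n + 3; w)\<close>, whose last factor has positive nonincreasing
  coefficients and so has no zero with \<open>|w| < 1\<close>, as in the theorem of Enestrom and Kakeya
  (\<open>eval_kernel_fps_nonzero\<close>). Hence \<open>0\<close> is the only zero of \<open>F\<^sub>1\<close>.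
\<close>

unbundle no vec_syntax

section \<open>Power series on the disc and the monomials\<close>

lemma disc_sums:
  assumes "f holomorphic_on unit_disc" and "z \<in> unit_disc"
  shows "(\<lambda>m. taylor_coeff f m * z ^ m) sums f z"
  using holomorphic_power_series[OF assms] by (simp add: taylor_coeff_def)

lemma disc_series_holomorphic:
  assumes "\<And>z. z \<in> unit_disc \<Longrightarrow> (\<lambda>m. a m * z ^ m) sums f z"
  shows "f holomorphic_on unit_disc"
  by (rule power_series_holomorphic[where a = a]) (use assms in simp)

lemma disc_series_has_fps_expansion:
  assumes "\<And>z. z \<in> unit_disc \<Longrightarrow> (\<lambda>m. a m * z ^ m) sums f z"
  shows "f has_fps_expansion Abs_fps a"
proof (rule has_fps_expansionI)
  have "eventually (\<lambda>z. z \<in> unit_disc) (nhds (0 :: complex))"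
    by (rule eventually_nhds_in_open) auto
  then show "eventually (\<lambda>u. (\<lambda>n. fps_nth (Abs_fps a) n * u ^ n) sums f u) (nhds 0)"
    by (rule eventually_mono) (simp add: assms)
qed

lemma disc_series_taylor_coeff:
  assumes "\<And>z. z \<in> unit_disc \<Longrightarrow> (\<lambda>m. a m * z ^ m) sums f z"
  shows "taylor_coeff f m = a m"
  using fps_nth_fps_expansion[OF disc_series_has_fps_expansion[OF assms], of m]
  by (simp add: taylor_coeff_def)

lemma taylor_coeff_add:
  assumes "f holomorphic_on unit_disc" and "g holomorphic_on unit_disc"
  shows "taylor_coeff (\<lambda>z. f z + g z) m = taylor_coeff f m + taylor_coeff g m"
  by (rule disc_series_taylor_coeff)
     (simp add: distrib_right sums_add disc_sums[OF assms(1)] disc_sums[OF assms(2)])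

lemma taylor_coeff_cmult:
  assumes "f holomorphic_on unit_disc"
  shows "taylor_coeff (\<lambda>z. \<alpha> * f z) m = \<alpha> * taylor_coeff f m"
  by (rule disc_series_taylor_coeff) (simp add: mult.assoc sums_mult disc_sums[OF assms])

lemma S21_weight_ge_1: "S21_weight m \<ge> 1"
  by (simp add: S21_weight_def field_simps)

lemma S21_weight_pos: "S21_weight m > 0"
  using S21_weight_ge_1[of m] by linarith

lemma S21_add:
  assumes "f \<in> S21" and "g \<in> S21"
  shows "(\<lambda>z. f z + g z) \<in> S21"
proof -
  have hol: "f holomorphic_on unit_disc" "g holomorphic_on unit_disc"
    using assms by (auto simp: S21_def)
  have summ: "summable (\<lambda>m. 2 * (S21_weight m * (cmod (taylor_coeff f m))\<^sup>2)
                     + 2 * (S21_weight m * (cmod (taylor_coeff g m))\<^sup>2))"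
    using assms by (intro summable_add summable_mult) (auto simp: S21_def)
  have coeff_bound: "S21_weight m * (cmod (taylor_coeff (\<lambda>z. f z + g z) m))\<^sup>2
      \<le> 2 * (S21_weight m * (cmod (taylor_coeff f m))\<^sup>2) + 2 * (S21_weight m * (cmod (taylor_coeff g m))\<^sup>2)" for m
  proof -
    have "(cmod (x + y))\<^sup>2 \<le> 2 * (cmod x)\<^sup>2 + 2 * (cmod y)\<^sup>2" for x y
    proof -
      have "(cmod (x + y))\<^sup>2 \<le> (cmod x + cmod y)\<^sup>2" by (intro power_mono norm_triangle_ineq) simp
      also have "\<dots> \<le> 2 * (cmod x)\<^sup>2 + 2 * (cmod y)\<^sup>2"
        using sum_squares_bound[of "cmod x" "cmod y"] by (simp add: power2_sum)
      finally show ?thesis .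
    qed
    then have "S21_weight m * (cmod (taylor_coeff f m + taylor_coeff g m))\<^sup>2
        \<le> S21_weight m * (2 * (cmod (taylor_coeff f m))\<^sup>2 + 2 * (cmod (taylor_coeff g m))\<^sup>2)"
      using S21_weight_pos[of m] by (intro mult_left_mono) auto
    then show ?thesis by (simp add: taylor_coeff_add[OF hol] algebra_simps)
  qed
  have "summable (\<lambda>m. S21_weight m * (cmod (taylor_coeff (\<lambda>z. f z + g z) m))\<^sup>2)"
  proof (rule summable_comparison_test'[OF summ, of 0])
    fix m
    have "norm (S21_weight m * (cmod x)\<^sup>2) = S21_weight m * (cmod x)\<^sup>2" for x
      using S21_weight_pos[of m] by simp
    with coeff_bound[of m]
    show "norm (S21_weight m * (cmod (taylor_coeff (\<lambda>z. f z + g z) m))\<^sup>2)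
       \<le> 2 * (S21_weight m * (cmod (taylor_coeff f m))\<^sup>2) + 2 * (S21_weight m * (cmod (taylor_coeff g m))\<^sup>2)"
      by (simp only:)
  qed
  then show ?thesis
    using assms unfolding S21_def by (auto intro!: holomorphic_intros)
qed

lemma S21_cmult:
  assumes "f \<in> S21"
  shows "(\<lambda>z. \<alpha> * f z) \<in> S21"
proof -
  have hol: "f holomorphic_on unit_disc" using assms by (auto simp: S21_def)
  have "summable (\<lambda>m. (cmod \<alpha>)\<^sup>2 * (S21_weight m * (cmod (taylor_coeff f m))\<^sup>2))"
    using assms by (intro summable_mult) (auto simp: S21_def)
  then have "summable (\<lambda>m. S21_weight m * (cmod (taylor_coeff (\<lambda>z. \<alpha> * f z) m))\<^sup>2)"
    by (simp add: taylor_coeff_cmult[OF hol] norm_mult power_mult_distrib mult_ac)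
  then show ?thesis
    using assms unfolding S21_def by (auto intro!: holomorphic_intros)
qed

text \<open>
  The function \<open>z\<^sup>j\<close> is cut off outside the disc, as membership in \<open>S21\<close> demands.
\<close>
definition disc_monomial :: "nat \<Rightarrow> complex \<Rightarrow> complex" where
  "disc_monomial j z = (if z \<in> unit_disc then z ^ j else 0)"

definition disc_poly :: "(nat \<Rightarrow> complex) \<Rightarrow> nat \<Rightarrow> complex \<Rightarrow> complex" where
  "disc_poly c N z = (\<Sum>m<N. c m * disc_monomial m z)"

lemma disc_poly_taylor_coeff: "taylor_coeff (disc_poly c N) m = (if m < N then c m else 0)"
proof (rule disc_series_taylor_coeff)
  fix z :: complex assume "z \<in> unit_disc"
  have "(\<lambda>m. (if m < N then c m else 0) * z ^ m) sums (\<Sum>m<N. (if m < N then c m else 0) * z ^ m)"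
    by (rule sums_finite) auto
  then show "(\<lambda>m. (if m < N then c m else 0) * z ^ m) sums disc_poly c N z"
    using \<open>z \<in> unit_disc\<close> by (simp add: disc_poly_def disc_monomial_def)
qed

lemma disc_poly_in_S21: "disc_poly c N \<in> S21"
proof -
  have "disc_poly c N holomorphic_on unit_disc \<longleftrightarrow> (\<lambda>z. \<Sum>m<N. c m * z ^ m) holomorphic_on unit_disc"
    by (rule holomorphic_cong) (auto simp: disc_poly_def disc_monomial_def)
  then have "disc_poly c N holomorphic_on unit_disc" by (auto intro!: holomorphic_intros)
  moreover have "summable (\<lambda>m. S21_weight m * (cmod (taylor_coeff (disc_poly c N) m))\<^sup>2)"
    by (rule summable_finite[of "{..<N}"]) (auto simp: disc_poly_taylor_coeff)
  ultimately show ?thesis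
    by (auto simp: S21_def) (auto simp: disc_poly_def disc_monomial_def)
qed

lemma disc_monomial_taylor_coeff: "taylor_coeff (disc_monomial j) m = (if m = j then 1 else 0)"
proof (rule disc_series_taylor_coeff)
  fix z :: complex assume "z \<in> unit_disc"
  then have "disc_monomial j z = z ^ j" by (simp add: disc_monomial_def)
  moreover have "(\<lambda>m. (if m = j then 1 else 0) * z ^ m) = (\<lambda>m. if m = j then z ^ m else 0)" by auto
  ultimately show "(\<lambda>m. (if m = j then 1 else 0) * z ^ m) sums disc_monomial j z"
    using sums_single[of j "\<lambda>m. z ^ m"] by simp
qed

lemma disc_monomial_in_S21: "disc_monomial j \<in> S21"
proof -
  have "disc_monomial j = disc_poly (\<lambda>m. if m = j then 1 else 0) (Suc j)"
    by (auto simp: disc_poly_def fun_eq_iff if_distrib cong: if_cong)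
  then show ?thesis using disc_poly_in_S21 by metis
qed

lemma S21_norm_disc_poly: "S21_norm (disc_poly c N) = sqrt (\<Sum>m<N. S21_weight m * (cmod (c m))\<^sup>2)"
  unfolding S21_norm_def
  by (subst suminf_finite[of "{..<N}"]) (auto simp: disc_poly_taylor_coeff)

text \<open>
  Uniqueness in \<open>S21\<close> uses the convention that its elements vanish off the disc: inside it they are
  determined by their Taylor coefficients.
\<close>
lemma S21_eqI:
  assumes "f \<in> S21" and "g \<in> S21" and "\<And>m. taylor_coeff f m = taylor_coeff g m"
  shows "f = g"
proof
  fix z show "f z = g z"
  proof (cases "z \<in> unit_disc")
    case True
    have "(\<lambda>m. taylor_coeff f m * z ^ m) sums f z" "(\<lambda>m. taylor_coeff f m * z ^ m) sums g z"
      using disc_sums[OF _ True, of f] disc_sums[OF _ True, of g] assms by (auto simp: S21_def)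
    then show ?thesis by (rule sums_unique2)
  qed (use assms(1,2) in \<open>auto simp: S21_def\<close>)
qed

lemma S21_inner_disc_monomial:
  "S21_inner (disc_monomial k) h = of_real (S21_weight k) * cnj (taylor_coeff h k)"
  unfolding S21_inner_def
  by (subst suminf_finite[of "{k}"]) (auto simp: disc_monomial_taylor_coeff)

lemma S21_inner_cmult_disc_monomial:
  "S21_inner f (\<lambda>z. \<alpha> * disc_monomial j z) = of_real (S21_weight j) * taylor_coeff f j * cnj \<alpha>"
proof -
  have "disc_monomial j holomorphic_on unit_disc" using disc_monomial_in_S21[of j] by (simp add: S21_def)
  then have "taylor_coeff (\<lambda>z. \<alpha> * disc_monomial j z) m = (if m = j then \<alpha> else 0)" for m
    by (simp add: taylor_coeff_cmult disc_monomial_taylor_coeff)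
  then show ?thesis
    unfolding S21_inner_def by (subst suminf_finite[of "{j}"]) auto
qed

lemma norm_coeff_le_S21_norm:
  assumes "f \<in> S21"
  shows "cmod (taylor_coeff f j) \<le> S21_norm f"
proof -
  have "(cmod (taylor_coeff f j))\<^sup>2 \<le> S21_weight j * (cmod (taylor_coeff f j))\<^sup>2"
    using mult_right_mono[OF S21_weight_ge_1[of j], of "(cmod (taylor_coeff f j))\<^sup>2"] by simp
  also have "\<dots> = (\<Sum>m\<in>{j}. S21_weight m * (cmod (taylor_coeff f m))\<^sup>2)" by simp
  also have "\<dots> \<le> (\<Sum>m. S21_weight m * (cmod (taylor_coeff f m))\<^sup>2)"
    using assms S21_weight_pos by (intro sum_le_suminf) (auto simp: S21_def less_imp_le)
  finally show ?thesis unfolding S21_norm_def by (rule real_le_rsqrt)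
qed

text \<open>
  The representing element can only have the coefficients \<open>c\<^sub>m = cnj (L z\<^sup>m) / w\<^sub>m\<close>, where \<open>w\<^sub>m\<close> is the weight.
  Applied to the partial sums of \<open>\<Sum> c\<^sub>m z\<^sup>m\<close>, the functional takes the value \<open>s\<^sub>N = \<Sum>\<^bsub>m < N\<^esub> w\<^sub>m |c\<^sub>m|\<^sup>2\<close>, which is also the
  square of their norm. So boundedness says \<open>s\<^sub>N \<le> K \<surd>s\<^sub>N\<close>, and the \<open>s\<^sub>N\<close> are bounded by \<open>K\<^sup>2\<close>.
  That \<open>L f\<close> is the inner product with this element follows since the Taylor polynomials of \<open>f\<close> converge to \<open>f\<close> in norm.
\<close>
theorem S21_riesz_representation:
  fixes L :: "(complex \<Rightarrow> complex) \<Rightarrow> complex"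
  assumes add: "\<And>f g. f \<in> S21 \<Longrightarrow> g \<in> S21 \<Longrightarrow> L (\<lambda>z. f z + g z) = L f + L g"
    and cmult: "\<And>f \<alpha>. f \<in> S21 \<Longrightarrow> L (\<lambda>z. \<alpha> * f z) = \<alpha> * L f"
    and bound: "\<And>f. f \<in> S21 \<Longrightarrow> cmod (L f) \<le> K * S21_norm f"
  shows "\<exists>!h. h \<in> S21 \<and> (\<forall>f\<in>S21. L f = S21_inner f h)"
proof -
  define l where "l m = L (disc_monomial m)" for m
  have L_poly: "L (disc_poly c N) = (\<Sum>m<N. c m * l m)" for c N
  proof (induction N)
    case 0
    have "disc_poly c 0 = (\<lambda>z. 0 * disc_monomial 0 z)" by (simp add: disc_poly_def fun_eq_iff)
    then show ?case using cmult[OF disc_monomial_in_S21, of 0 0] by simp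
  next
    case (Suc N)
    have "disc_poly c (Suc N) = (\<lambda>z. disc_poly c N z + c N * disc_monomial N z)"
      by (simp add: disc_poly_def fun_eq_iff)
    then have "L (disc_poly c (Suc N)) = L (disc_poly c N) + L (\<lambda>z. c N * disc_monomial N z)"
      using add[OF disc_poly_in_S21 S21_cmult[OF disc_monomial_in_S21]] by simp
    then show ?case using Suc cmult[OF disc_monomial_in_S21] by (simp add: l_def)
  qed
  define c where "c m = cnj (l m) / of_real (S21_weight m)" for m
  have l_c: "of_real (S21_weight m) * cnj (c m) = l m" for m
    using S21_weight_pos[of m] by (simp add: c_def)
  have c_term: "c m * l m = of_real (S21_weight m * (cmod (c m))\<^sup>2)" for m
    unfolding l_c[of m, symmetric] by (simp only: of_real_mult complex_norm_square mult.left_commute)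
  have c_partial: "(\<Sum>m<N. S21_weight m * (cmod (c m))\<^sup>2) \<le> K\<^sup>2" for N
  proof -
    define s where "s = (\<Sum>m<N. S21_weight m * (cmod (c m))\<^sup>2)"
    have "s \<ge> 0" unfolding s_def using S21_weight_pos by (intro sum_nonneg) (auto simp: less_imp_le)
    have "L (disc_poly c N) = of_real s" by (simp add: L_poly c_term s_def)
    then have "s \<le> K * sqrt s"
      using bound[OF disc_poly_in_S21, of c N] \<open>s \<ge> 0\<close> by (simp add: S21_norm_disc_poly s_def[symmetric])
    then have "sqrt s * sqrt s \<le> K * sqrt s" using \<open>s \<ge> 0\<close> by simp
    have "s \<le> K\<^sup>2"
    proof (cases "s = 0")
      case False
      with \<open>s \<ge> 0\<close> have "sqrt s > 0" by simp
      with \<open>sqrt s * sqrt s \<le> K * sqrt s\<close> have "sqrt s \<le> K" by (metis mult_right_le_imp_le)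
      then have "(sqrt s)\<^sup>2 \<le> K\<^sup>2" using \<open>sqrt s > 0\<close> by (intro power_mono) auto
      then show ?thesis using \<open>s \<ge> 0\<close> by simp
    qed simp
    then show ?thesis by (simp only: s_def)
  qed
  have c_summable: "summable (\<lambda>m. S21_weight m * (cmod (c m))\<^sup>2)"
  proof (rule bounded_imp_summable)
    show "S21_weight m * (cmod (c m))\<^sup>2 \<ge> 0" for m using S21_weight_pos[of m] by simp
    show "(\<Sum>m\<le>N. S21_weight m * (cmod (c m))\<^sup>2) \<le> K\<^sup>2" for N
      using c_partial[of "Suc N"] by (simp only: lessThan_Suc_atMost)
  qed
  have c_bound: "cmod (c m) \<le> \<bar>K\<bar>" for m
  proof -
    have "(cmod (c m))\<^sup>2 \<le> S21_weight m * (cmod (c m))\<^sup>2"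
      using mult_right_mono[OF S21_weight_ge_1[of m], of "(cmod (c m))\<^sup>2"] by simp
    also have "\<dots> \<le> (\<Sum>i<Suc m. S21_weight i * (cmod (c i))\<^sup>2)"
      using S21_weight_pos by (simp add: sum_nonneg less_imp_le)
    also have "\<dots> \<le> K\<^sup>2" by (rule c_partial)
    finally show ?thesis using abs_le_square_iff[of "cmod (c m)" K] by simp
  qed
  define h where "h z = (if z \<in> unit_disc then \<Sum>m. c m * z ^ m else 0)" for z
  have h_sums: "(\<lambda>m. c m * z ^ m) sums h z" if "z \<in> unit_disc" for z
  proof -
    have "summable (\<lambda>m. \<bar>K\<bar> * cmod z ^ m)"
      using that by (intro summable_mult summable_geometric) simp
    moreover have "norm (c m * z ^ m) \<le> \<bar>K\<bar> * cmod z ^ m" for m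
      unfolding norm_mult norm_power by (rule mult_right_mono[OF c_bound]) simp
    ultimately have "summable (\<lambda>m. c m * z ^ m)"
      by (rule summable_comparison_test'[of _ 0])
    then show ?thesis using that by (simp add: h_def summable_sums)
  qed
  have h_coeff: "taylor_coeff h m = c m" for m
    by (rule disc_series_taylor_coeff[OF h_sums])
  have h: "h \<in> S21"
  proof -
    have "h holomorphic_on unit_disc" by (rule disc_series_holomorphic[OF h_sums])
    moreover have "\<forall>z. z \<notin> unit_disc \<longrightarrow> h z = 0" by (simp add: h_def)
    ultimately show ?thesis using c_summable by (simp only: S21_def mem_Collect_eq h_coeff)
  qed
  have "L f = S21_inner f h" if f: "f \<in> S21" for f
  proof -
    define q where "q = taylor_coeff f"
    have hol: "f holomorphic_on unit_disc" using f by (simp add: S21_def)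
    have summ: "summable (\<lambda>m. S21_weight m * (cmod (q m))\<^sup>2)" using f by (simp add: S21_def q_def)
    \<comment> \<open>the remainder after the Taylor polynomial of degree less than \<open>N\<close> has the tail of the norm series as its squared norm\<close>
    have tail: "cmod ((\<Sum>m<N. q m * l m) - L f) \<le> K * sqrt (\<Sum>m. S21_weight (m + N) * (cmod (q (m + N)))\<^sup>2)" for N
    proof -
      define g where "g = (\<lambda>z. f z + (-1) * disc_poly q N z)"
      have "g \<in> S21" unfolding g_def by (intro S21_add S21_cmult f disc_poly_in_S21)
      have poly_hol: "disc_poly q N holomorphic_on unit_disc" "(\<lambda>z. (-1) * disc_poly q N z) holomorphic_on unit_disc"
        using disc_poly_in_S21[of q N] S21_cmult[OF disc_poly_in_S21[of q N], of "-1"] by (simp_all add: S21_def)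
      have g_coeff: "taylor_coeff g m = (if m < N then 0 else q m)" for m
        unfolding g_def taylor_coeff_add[OF hol poly_hol(2)] taylor_coeff_cmult[OF poly_hol(1)]
        by (simp add: disc_poly_taylor_coeff q_def)
      have "L g = L f - (\<Sum>m<N. q m * l m)"
        unfolding g_def add[OF f S21_cmult[OF disc_poly_in_S21]] cmult[OF disc_poly_in_S21] L_poly by simp
      moreover have "S21_norm g = sqrt (\<Sum>m. S21_weight (m + N) * (cmod (q (m + N)))\<^sup>2)"
      proof -
        have "summable (\<lambda>m. S21_weight m * (cmod (taylor_coeff g m))\<^sup>2)"
          using \<open>g \<in> S21\<close> by (simp add: S21_def)
        from suminf_split_initial_segment[OF this, of N] show ?thesis
          unfolding S21_norm_def by (simp add: g_coeff)
      qed
      ultimately show ?thesis using bound[OF \<open>g \<in> S21\<close>] by (simp add: norm_minus_commute)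
    qed
    have "(\<lambda>N. \<Sum>m. S21_weight (m + N) * (cmod (q (m + N)))\<^sup>2) \<longlonglongrightarrow> 0"
      by (rule suminf_exist_split2[OF summ])
    from tendsto_mult_left[OF tendsto_real_sqrt[OF this], of K]
    have "(\<lambda>N. K * sqrt (\<Sum>m. S21_weight (m + N) * (cmod (q (m + N)))\<^sup>2)) \<longlonglongrightarrow> 0"
      by (simp only: real_sqrt_zero mult_zero_right)
    then have "(\<lambda>N. (\<Sum>m<N. q m * l m) - L f) \<longlonglongrightarrow> 0"
      by (rule Lim_null_comparison[OF always_eventually[OF allI[OF tail]]])
    then have "(\<lambda>m. q m * l m) sums L f"
      unfolding sums_def by (rule LIM_zero_cancel)
    moreover have "q m * l m = of_real (S21_weight m) * taylor_coeff f m * cnj (taylor_coeff h m)" for m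
      unfolding h_coeff q_def l_c[of m, symmetric] by simp
    ultimately show ?thesis unfolding S21_inner_def by (simp add: sums_iff)
  qed
  with h have ex: "h \<in> S21 \<and> (\<forall>f\<in>S21. L f = S21_inner f h)" by blast
  moreover have "h' = h" if h': "h' \<in> S21 \<and> (\<forall>f\<in>S21. L f = S21_inner f h')" for h'
  proof (rule S21_eqI)
    fix m
    have "S21_inner (disc_monomial m) h' = S21_inner (disc_monomial m) h"
      using ex h' disc_monomial_in_S21 by metis
    then show "taylor_coeff h' m = taylor_coeff h m"
      using S21_weight_pos[of m] by (simp add: S21_inner_disc_monomial)
  qed (use h' h in auto)
  ultimately show ?thesis by blast
qed

section \<open>Complex symmetry as an identity between matrix entries\<close>

text \<open>
  The adjoint is a definite description, so the defining property is available only once existence and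
  uniqueness are known. For multiples of monomials the functional \<open>f \<mapsto> \<langle>T f, g\<rangle>\<close> is a multiple of a single
  Taylor coefficient of \<open>T f\<close>, which makes its boundedness immediate.
\<close>
lemma S21_adjoint_of_monomial:
  fixes T :: operator and \<alpha> :: complex and j :: nat
  assumes "S21_bounded T"
  defines "g \<equiv> (\<lambda>z. \<alpha> * disc_monomial j z)"
  shows "S21_adjoint T g \<in> S21"
    and "f \<in> S21 \<Longrightarrow> S21_inner (T f) g = S21_inner f (S21_adjoint T g)"
proof -
  define L where "L f = S21_inner (T f) g" for f
  have L: "L f = of_real (S21_weight j) * taylor_coeff (T f) j * cnj \<alpha>" for f
    by (simp add: L_def g_def S21_inner_cmult_disc_monomial)
  have T: "T f \<in> S21" if "f \<in> S21" for f using assms(1) that by (simp add: S21_bounded_def)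
  have T_hol: "T f holomorphic_on unit_disc" if "f \<in> S21" for f using T[OF that] by (simp add: S21_def)
  obtain K where K: "\<And>f. f \<in> S21 \<Longrightarrow> S21_norm (T f) \<le> K * S21_norm f"
    using assms(1) unfolding S21_bounded_def by blast
  have "\<exists>!h. h \<in> S21 \<and> (\<forall>f\<in>S21. L f = S21_inner f h)"
  proof (rule S21_riesz_representation)
    fix f g assume fg: "f \<in> S21" "g \<in> S21"
    then have "T (\<lambda>z. f z + g z) = (\<lambda>z. T f z + T g z)" using assms(1) by (simp add: S21_bounded_def)
    then show "L (\<lambda>z. f z + g z) = L f + L g"
      unfolding L by (simp add: taylor_coeff_add[OF T_hol T_hol] fg algebra_simps)
  next
    fix f x assume f: "f \<in> S21"
    then have "T (\<lambda>z. x * f z) = (\<lambda>z. x * T f z)" using assms(1) by (simp add: S21_bounded_def)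
    then show "L (\<lambda>z. x * f z) = x * L f"
      unfolding L by (simp add: taylor_coeff_cmult[OF T_hol] f)
  next
    fix f assume f: "f \<in> S21"
    have "cmod (L f) = S21_weight j * cmod \<alpha> * cmod (taylor_coeff (T f) j)"
      using S21_weight_pos[of j] by (simp add: L norm_mult)
    also have "\<dots> \<le> S21_weight j * cmod \<alpha> * S21_norm (T f)"
      using S21_weight_pos[of j] by (intro mult_left_mono norm_coeff_le_S21_norm T f) simp
    also have "\<dots> \<le> S21_weight j * cmod \<alpha> * (K * S21_norm f)"
      using S21_weight_pos[of j] by (intro mult_left_mono K f) simp
    finally show "cmod (L f) \<le> (S21_weight j * cmod \<alpha> * K) * S21_norm f" by (simp only: mult.assoc)
  qed
  from theI'[OF this]
  have *: "S21_adjoint T g \<in> S21 \<and> (\<forall>f\<in>S21. L f = S21_inner f (S21_adjoint T g))"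
    unfolding S21_adjoint_def L_def .
  then show "S21_adjoint T g \<in> S21"
    and "f \<in> S21 \<Longrightarrow> S21_inner (T f) g = S21_inner f (S21_adjoint T g)"
    by (auto simp: L_def)
qed

lemma conjugation_taylor_coeff:
  assumes "h \<in> S21" and "cmod \<eta> = 1"
  shows "taylor_coeff (conjugation \<mu> \<eta> h) k = \<mu> * \<eta> ^ k * cnj (taylor_coeff h k)"
proof (rule disc_series_taylor_coeff)
  fix z :: complex assume "z \<in> unit_disc"
  then have "cnj (\<eta> * z) \<in> unit_disc" using assms(2) by (simp add: norm_mult)
  then have "(\<lambda>m. taylor_coeff h m * cnj (\<eta> * z) ^ m) sums h (cnj (\<eta> * z))"
    using assms(1) by (intro disc_sums) (auto simp: S21_def)
  then have "(\<lambda>m. cnj (taylor_coeff h m * cnj (\<eta> * z) ^ m)) sums cnj (h (cnj (\<eta> * z)))"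
    by (simp only: sums_cnj)
  from sums_mult[OF this, of \<mu>]
  show "(\<lambda>k. \<mu> * \<eta> ^ k * cnj (taylor_coeff h k) * z ^ k) sums conjugation \<mu> \<eta> h z"
    by (simp add: conjugation_def power_mult_distrib mult_ac)
qed

lemma conjugation_disc_monomial:
  assumes "cmod \<eta> = 1"
  shows "conjugation \<mu> \<eta> (disc_monomial j) = (\<lambda>z. (\<mu> * \<eta> ^ j) * disc_monomial j z)"
  using assms by (auto simp: conjugation_def disc_monomial_def norm_mult power_mult_distrib fun_eq_iff)

lemma delta_S21_weight: "delta m * of_real (S21_weight m) = 1"
proof -
  have "delta m = of_real (1 / S21_weight m)" by (simp add: delta_def S21_weight_def)
  then show ?thesis using S21_weight_pos[of m] by simp
qed

text \<open>
  Put \<open>g = C z\<^sup>j = \<mu> \<eta>\<^sup>j z\<^sup>j\<close> and \<open>h = T\<^sup>* g\<close>. Then \<open>T z\<^sup>j = C h\<close> expresses \<open>A k j\<close> through \<open>h\<^sub>k\<close>, and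
  \<open>\<langle>T z\<^sup>k, g\<rangle> = \<langle>z\<^sup>k, h\<rangle>\<close> expresses \<open>h\<^sub>k\<close> through \<open>A j k\<close>. The factors \<open>\<mu>\<close> cancel because \<open>|\<mu>| = 1\<close>.
\<close>
lemma complex_symmetric_entries:
  assumes "S21_bounded T" and "complex_symmetric T (conjugation \<mu> \<eta>)"
    and "cmod \<mu> = 1" and "cmod \<eta> = 1"
  shows "\<eta> ^ j * delta j * taylor_coeff (T (disc_monomial j)) k
       = \<eta> ^ k * delta k * taylor_coeff (T (disc_monomial k)) j"
proof -
  define \<alpha> where "\<alpha> = \<mu> * \<eta> ^ j"
  define h where "h = S21_adjoint T (\<lambda>z. \<alpha> * disc_monomial j z)"
  note h = S21_adjoint_of_monomial[OF assms(1), where \<alpha> = \<alpha> and j = j, folded h_def]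
  have unit: "\<alpha> * cnj \<alpha> = 1"
  proof -
    have "cmod \<alpha> = 1" using assms(3,4) by (simp add: \<alpha>_def norm_mult norm_power)
    then show ?thesis by (simp flip: complex_norm_square)
  qed
  have "T (disc_monomial j) = conjugation \<mu> \<eta> h"
    using assms(2) disc_monomial_in_S21
    unfolding complex_symmetric_def conjugation_disc_monomial[OF assms(4)] h_def \<alpha>_def
    by (simp add: conjugation_disc_monomial[OF assms(4)])
  then have "taylor_coeff (T (disc_monomial j)) k = \<mu> * \<eta> ^ k * cnj (taylor_coeff h k)"
    by (simp add: conjugation_taylor_coeff h(1) assms(4))
  moreover have "of_real (S21_weight j) * taylor_coeff (T (disc_monomial k)) j * cnj \<alpha>
      = of_real (S21_weight k) * cnj (taylor_coeff h k)"
    using h(2)[OF disc_monomial_in_S21[of k]]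
    by (simp only: S21_inner_cmult_disc_monomial S21_inner_disc_monomial)
  moreover have "\<eta> ^ j * delta j * (\<mu> * \<eta> ^ k * cnj (taylor_coeff h k))
      = \<alpha> * \<eta> ^ k * delta j * (delta k * (of_real (S21_weight k) * cnj (taylor_coeff h k)))"
    using delta_S21_weight[of k] by (simp add: \<alpha>_def mult_ac)
  moreover have "\<alpha> * \<eta> ^ k * delta j * (delta k * (of_real (S21_weight j) * x * cnj \<alpha>))
      = \<eta> ^ k * delta k * x" for x
  proof -
    have "\<alpha> * \<eta> ^ k * delta j * (delta k * (of_real (S21_weight j) * x * cnj \<alpha>))
        = (\<alpha> * cnj \<alpha>) * (delta j * of_real (S21_weight j)) * (\<eta> ^ k * delta k * x)" by (simp only: mult_ac)
    then show ?thesis by (simp only: unit delta_S21_weight mult_1)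
  qed
  ultimately show ?thesis by metis
qed

text \<open>
  The coefficient of \<open>z\<^sup>k\<close> in \<open>D\<^sub>n\<^sub>,\<^sub>\<psi>\<^sub>,\<^sub>\<phi> z\<^sup>j\<close>, in terms of the Taylor series of the symbols at \<open>0\<close>.
\<close>
definition comp_diff_entry :: "nat \<Rightarrow> complex fps \<Rightarrow> complex fps \<Rightarrow> nat \<Rightarrow> nat \<Rightarrow> complex" where
  "comp_diff_entry n \<Psi> \<Phi> k j = (if j < n then 0 else fact j / fact (j - n) * (\<Psi> * \<Phi> ^ (j - n)) $ k)"

lemma higher_deriv_monomial:
  "(deriv ^^ n) (\<lambda>w::complex. w ^ j) = (\<lambda>w. if j < n then 0 else fact j / fact (j - n) * w ^ (j - n))"
proof (induction n)
  case (Suc n)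
  have "deriv (\<lambda>w. if j < n then 0 else fact j / fact (j - n) * w ^ (j - n)) w
     = (if j < Suc n then 0 else fact j / fact (j - Suc n) * w ^ (j - Suc n))" for w :: complex
  proof (cases "j < Suc n")
    case False
    then obtain i where "j = Suc (n + i)" by (metis add_Suc less_iff_Suc_add not_less_eq)
    then have ij: "j - n = Suc i" "j - Suc n = i" "(j < n) = False" "(j < Suc n) = False" by auto
    have "((\<lambda>w. fact j / fact (Suc i) * w ^ Suc i) has_field_derivative
            fact j / fact (Suc i) * (of_nat (Suc i) * w ^ i)) (at w)"
      by (auto intro!: derivative_eq_intros simp del: power_Suc fact_Suc)
    then have "deriv (\<lambda>w. fact j / fact (Suc i) * w ^ Suc i) w = fact j / fact (Suc i) * (of_nat (Suc i) * w ^ i)"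
      by (rule DERIV_imp_deriv)
    also have "\<dots> = fact j / fact i * w ^ i" by (simp add: divide_simps del: of_nat_Suc)
    finally show ?thesis by (simp only: ij if_False)
  next
    case True
    then show ?thesis by (cases "j < n") auto
  qed
  then show ?case by (simp add: Suc fun_eq_iff)
qed simp

lemma taylor_coeff_eq_fps_nth:
  "f has_fps_expansion F \<Longrightarrow> taylor_coeff f m = F $ m"
  by (simp add: taylor_coeff_def fps_nth_fps_expansion)

lemma comp_diff_disc_monomial_taylor_coeff:
  assumes "\<phi> holomorphic_on unit_disc" and "\<phi> ` unit_disc \<subseteq> unit_disc" and "\<psi> holomorphic_on unit_disc"
  shows "taylor_coeff (comp_diff n \<psi> \<phi> (disc_monomial j)) k
       = comp_diff_entry n (fps_expansion \<psi> 0) (fps_expansion \<phi> 0) k j"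
proof -
  have e: "\<psi> has_fps_expansion fps_expansion \<psi> 0" "\<phi> has_fps_expansion fps_expansion \<phi> 0"
    using assms by (auto intro!: has_fps_expansion_fps_expansion[of unit_disc])
  define C :: complex where "C = (if j < n then 0 else fact j / fact (j - n))"
  have "(\<lambda>z. C * (\<psi> z * \<phi> z ^ (j - n))) has_fps_expansion
          fps_const C * (fps_expansion \<psi> 0 * fps_expansion \<phi> 0 ^ (j - n))"
    by (intro fps_expansion_intros e)
  moreover have "comp_diff n \<psi> \<phi> (disc_monomial j) z = C * (\<psi> z * \<phi> z ^ (j - n))"
    if z: "z \<in> unit_disc" for z
  proof -
    have "\<phi> z \<in> unit_disc" using assms(2) z by blast
    then have "eventually (\<lambda>w. w \<in> unit_disc) (nhds (\<phi> z))" by (intro eventually_nhds_in_open) auto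
    then have "eventually (\<lambda>w. disc_monomial j w = w ^ j) (nhds (\<phi> z))"
      by (rule eventually_mono) (simp add: disc_monomial_def)
    then have "(deriv ^^ n) (disc_monomial j) (\<phi> z) = (deriv ^^ n) (\<lambda>w. w ^ j) (\<phi> z)"
      by (rule higher_deriv_cong_ev) simp
    then show ?thesis using z by (simp add: comp_diff_def higher_deriv_monomial C_def)
  qed
  then have "eventually (\<lambda>z. comp_diff n \<psi> \<phi> (disc_monomial j) z = C * (\<psi> z * \<phi> z ^ (j - n))) (nhds 0)"
    by (intro eventually_mono[OF eventually_nhds_in_open[of unit_disc 0]]) auto
  ultimately have "comp_diff n \<psi> \<phi> (disc_monomial j) has_fps_expansion
          fps_const C * (fps_expansion \<psi> 0 * fps_expansion \<phi> 0 ^ (j - n))"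
    by (subst has_fps_expansion_cong[OF _ refl])
  then show ?thesis
    by (simp add: taylor_coeff_eq_fps_nth comp_diff_entry_def C_def)
qed

section \<open>Formal power series with symmetric entries\<close>

text \<open>
  With the factor \<open>z\<^sup>p\<close> split off, the series with lower limit \<open>p\<close> depends on \<open>w = \<beta> z\<close> only; this is its expansion in
  \<open>w\<close>. Up to a constant factor it is \<open>\<^sub>2F\<^sub>1(p + 1, p + 1; p + 3; w)\<close>.
\<close>
definition kernel_fps :: "nat \<Rightarrow> complex fps" where
  "kernel_fps p = Abs_fps (\<lambda>j. fact (j + p) / fact j * delta (j + p))"

lemma kernel_fps_nth: "kernel_fps p $ j = fact (j + p) / fact j * delta (j + p)"
  by (simp add: kernel_fps_def)

lemma delta_eq_of_nat: "delta k = 2 / (of_nat (Suc k) * of_nat (Suc (Suc k)))"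
  by (simp add: delta_def add_ac)

lemma kernel_fps_Suc_of_nat:
  "of_nat (Suc j) * of_nat (j + p + 3) * kernel_fps p $ Suc j
     = (of_nat (Suc (j + p)))\<^sup>2 * kernel_fps p $ j"
proof -
  have "j + p + 3 = Suc (Suc (Suc (j + p)))" by simp
  then show ?thesis
    by (simp add: kernel_fps_nth delta_eq_of_nat power2_eq_square field_simps del: of_nat_Suc of_nat_add)
qed

lemma kernel_fps_nonzero: "kernel_fps p $ j \<noteq> 0"
  by (simp add: kernel_fps_nth delta_eq_of_nat del: of_nat_Suc of_nat_add)

definition F_fps :: "nat \<Rightarrow> complex \<Rightarrow> complex fps" where
  "F_fps p \<beta> = Abs_fps (\<lambda>k. if k < p then 0 else fact k / fact (k - p) * delta k * \<beta> ^ (k - p))"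

lemma F_fps_nth_add: "F_fps p \<beta> $ (j + p) = kernel_fps p $ j * \<beta> ^ j"
  by (simp add: F_fps_def kernel_fps_nth)

lemma F_fps_nth_less: "k < p \<Longrightarrow> F_fps p \<beta> $ k = 0"
  by (simp add: F_fps_def)

lemma fps_power_nth_1:
  fixes F :: "'a::comm_ring_1 fps"
  shows "(F ^ m) $ Suc 0 = of_nat m * (F $ 0) ^ (m - 1) * F $ Suc 0"
proof (induction m)
  case (Suc m)
  then show ?case
    by (cases m) (simp_all add: fps_mult_nth fps_power_zeroth algebra_simps)
qed simp

text \<open>
  The consequences of the symmetry relation are purely algebraic, so they are drawn for arbitrary
  formal power series \<open>\<Psi>\<close> and \<open>\<Phi>\<close>.
\<close>
locale symmetric_entries =
  fixes n :: nat and \<eta> :: complex and \<Psi> \<Phi> :: "complex fps"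
  assumes eta: "\<eta> \<noteq> 0"
    and sym: "\<And>k j. \<eta> ^ j * delta j * comp_diff_entry n \<Psi> \<Phi> k j
                     = \<eta> ^ k * delta k * comp_diff_entry n \<Psi> \<Phi> j k"
begin

definition a where "a = \<Psi> $ n"
definition b where "b = \<Phi> $ 0"
definition c where "c = \<Phi> $ Suc 0"
definition p where "p = fps_shift n \<Psi>"

lemma delta_nonzero: "delta k \<noteq> 0"
  by (simp add: delta_eq_of_nat del: of_nat_Suc)

text \<open>
  The operator annihilates \<open>z\<^sup>k\<close> for \<open>k < n\<close>, so by symmetry row \<open>k\<close> vanishes too; its entry in column \<open>n\<close> is \<open>n! \<Psi>\<^sub>k\<close>.
\<close>
lemma Psi_nth_less: "k < n \<Longrightarrow> \<Psi> $ k = 0"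
  using sym[of n k] eta delta_nonzero[of n] by (simp add: comp_diff_entry_def)

lemma Psi_eq: "\<Psi> = fps_X ^ n * p"
  by (auto simp: fps_eq_iff p_def fps_X_power_mult_nth Psi_nth_less)

lemma p_0: "p $ 0 = a"
  by (simp add: p_def a_def)

lemma Psi_mult_eq: "\<Psi> * F = fps_X ^ n * (p * F)"
  by (subst Psi_eq) (rule mult.assoc)

lemma Psi_mult_nth: "(\<Psi> * F) $ (n + i) = (p * F) $ i"
  by (simp add: Psi_mult_eq fps_X_power_mult_nth)

text \<open>
  Here column \<open>n\<close> is compared with row \<open>n\<close>: the \<open>n\<close>-th coefficient of \<open>\<Psi> \<Phi>\<^sup>j\<close> is \<open>a b\<^sup>j\<close>.
\<close>
lemma p_nth: "p $ j = a / kernel_fps n $ 0 * kernel_fps n $ j * (\<eta> * b) ^ j"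
proof -
  have col: "comp_diff_entry n \<Psi> \<Phi> (n + j) n = fact n * p $ j"
    using Psi_mult_nth[of 1 j] by (simp add: comp_diff_entry_def)
  have row: "comp_diff_entry n \<Psi> \<Phi> n (n + j) = fact (n + j) / fact j * (a * b ^ j)"
    using Psi_mult_nth[of "\<Phi> ^ j" 0] by (simp add: comp_diff_entry_def fps_power_zeroth p_0 b_def)
  have "\<eta> ^ n * delta n * (fact n * p $ j)
      = \<eta> ^ (n + j) * delta (n + j) * (fact (n + j) / fact j * (a * b ^ j))"
    using sym[of n "n + j"] unfolding col row .
  also have "\<dots> = \<eta> ^ n * (a * kernel_fps n $ j * (\<eta> * b) ^ j)"
    unfolding kernel_fps_nth power_add power_mult_distrib by (simp add: ac_simps)
  finally have "kernel_fps n $ 0 * p $ j = a * kernel_fps n $ j * (\<eta> * b) ^ j"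
    using eta by (simp add: kernel_fps_nth[of n 0] ac_simps)
  then show ?thesis
    using kernel_fps_nonzero[of n 0] by (metis nonzero_mult_div_cancel_left times_divide_eq_left)
qed

lemma Psi_formula: "\<Psi> = fps_const (a / (fact n * delta n)) * F_fps n (\<eta> * b)"
proof (rule fps_ext)
  fix k show "\<Psi> $ k = (fps_const (a / (fact n * delta n)) * F_fps n (\<eta> * b)) $ k"
  proof (cases "k < n")
    case True
    then show ?thesis by (simp only: Psi_nth_less F_fps_nth_less fps_mult_left_const_nth mult_zero_right)
  next
    case False
    then obtain j where k: "k = j + n" by (metis add.commute le_Suc_ex not_less)
    have "\<Psi> $ k = p $ j" by (simp add: k p_def)
    also have "\<dots> = a / (fact n * delta n) * F_fps n (\<eta> * b) $ k"
      unfolding k F_fps_nth_add p_nth[of j] kernel_fps_nth[of n 0] by simp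
    finally show ?thesis by (simp only: fps_mult_left_const_nth)
  qed
qed

definition h where "h = \<Phi> - fps_const b"

text \<open>
  Here column \<open>n + 1\<close> is compared with row \<open>n + 1\<close>, where the coefficient of \<open>\<Psi> \<Phi>\<^bsup>m + 1\<^esup>\<close> is
  \<open>p\<^sub>1 b\<^bsup>m + 1\<^esup> + (m + 1) a b\<^sup>m c\<close>. The first summand matches the part \<open>b \<Psi>\<close> of \<open>\<Psi> \<Phi> = b \<Psi> + \<Psi> h\<close>, so the second
  one gives \<open>\<Psi> h\<close>.
\<close>
lemma Psi_h_formula:
  "\<Psi> * h = fps_const (a * c / (fact (n + 1) * delta (n + 1))) * F_fps (n + 1) (\<eta> * b)"
proof (rule fps_ext)
  fix k show "(\<Psi> * h) $ k
    = (fps_const (a * c / (fact (n + 1) * delta (n + 1))) * F_fps (n + 1) (\<eta> * b)) $ k"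
  proof (cases "k \<le> n")
    case True
    have "h $ 0 = 0" by (simp add: h_def b_def)
    then have "(\<Psi> * h) $ k = 0"
      using True unfolding Psi_mult_eq fps_X_power_mult_nth by (simp add: fps_mult_nth_0)
    moreover have "F_fps (n + 1) (\<eta> * b) $ k = 0" using True by (simp add: F_fps_nth_less)
    ultimately show ?thesis by simp
  next
    case False
    then have "n + 1 \<le> k" by simp
    then obtain m where k: "k = m + (n + 1)" by (metis add.commute le_Suc_ex)
    define d f dk fk fm r where "d = delta (n + 1)" and "f = (fact (n + 1) :: complex)" and "dk = delta k"
      and "fk = (fact k :: complex)" and "fm = (fact m :: complex)" and "r = a / kernel_fps n $ 0"
    define x where "x = fk / fact (Suc m)"
    have nz: "d \<noteq> 0" "fm \<noteq> 0" "x = fk / (of_nat (Suc m) * fm)" "f \<noteq> 0"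
      by (simp_all add: d_def fm_def x_def delta_nonzero) (simp only: f_def fact_nonzero not_False_eq_True)
    have p1: "p $ 1 = r * (f * d) * (\<eta> * b)"
    proof -
      have "kernel_fps n $ 1 = f * d" by (simp add: kernel_fps_nth f_def d_def)
      then show ?thesis by (simp only: p_nth[of 1] r_def power_one_right)
    qed
    have Psi_k: "\<Psi> $ k = r * (x * dk) * (\<eta> * b) ^ Suc m"
    proof -
      have k': "k = n + Suc m" "Suc m + n = k" by (simp_all add: k)
      have "\<Psi> $ k = p $ Suc m" using Psi_mult_nth[of 1 "Suc m"] by (simp add: k'(1))
      also have "\<dots> = r * (x * dk) * (\<eta> * b) ^ Suc m"
        unfolding p_nth r_def kernel_fps_nth[of n "Suc m"] k'(2) by (simp only: x_def fk_def dk_def)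
      finally show ?thesis .
    qed
    have eta_k: "\<eta> ^ k = \<eta> ^ m * \<eta> ^ (n + 1)" by (simp only: k power_add)
    \<comment> \<open>the symmetry relation for the column \<open>n + 1\<close> and the row \<open>k\<close>\<close>
    have "\<eta> ^ (n + 1) * d * (f * (\<Psi> * \<Phi>) $ k)
      = \<eta> ^ k * dk * (x * (p $ 1 * b ^ Suc m + a * (of_nat (Suc m) * b ^ m * c)))"
    proof -
      have "(\<Psi> * \<Phi> ^ Suc m) $ (n + 1) = p $ 1 * b ^ Suc m + a * (of_nat (Suc m) * b ^ m * c)"
        unfolding Psi_mult_nth
        by (simp add: fps_mult_nth[of p] fps_power_zeroth fps_power_nth_1 p_0 b_def c_def del: power_Suc of_nat_Suc)
      moreover have "comp_diff_entry n \<Psi> \<Phi> k (n + 1) = f * (\<Psi> * \<Phi>) $ k"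
        by (simp add: comp_diff_entry_def f_def)
      moreover have "comp_diff_entry n \<Psi> \<Phi> (n + 1) k = x * (\<Psi> * \<Phi> ^ Suc m) $ (n + 1)"
      proof -
        have "\<not> k < n" "k - n = Suc m" by (simp_all add: k)
        then show ?thesis by (simp only: comp_diff_entry_def if_False x_def fk_def)
      qed
      ultimately show ?thesis using sym[of "n + 1" k] by (simp only: d_def dk_def)
    qed
    \<comment> \<open>the contribution of \<open>b \<Psi>\<close>, to be subtracted\<close>
    moreover have "\<eta> ^ (n + 1) * d * (f * (b * \<Psi> $ k)) = \<eta> ^ k * dk * (x * (p $ 1 * b ^ Suc m))"
      unfolding eta_k p1 Psi_k by (simp add: power_mult_distrib)
    moreover have "(\<Psi> * h) $ k = (\<Psi> * \<Phi>) $ k - b * \<Psi> $ k"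
      by (simp add: h_def right_diff_distrib mult.commute)
    ultimately have "\<eta> ^ (n + 1) * d * (f * (\<Psi> * h) $ k)
        = \<eta> ^ k * dk * (x * (a * (of_nat (Suc m) * b ^ m * c)))"
      by (simp only: right_diff_distrib distrib_left) simp
    then have "d * f * (\<Psi> * h) $ k = \<eta> ^ m * dk * (x * (a * (of_nat (Suc m) * b ^ m * c)))"
      using eta unfolding eta_k by (simp add: mult.assoc)
    also have "\<dots> = a * c * (fk / fm * dk * (\<eta> * b) ^ m)"
      unfolding nz(3) using nz(2) by (simp add: power_mult_distrib del: of_nat_Suc)
    finally have "(\<Psi> * h) $ k = a * c / (f * d) * (fk / fm * dk * (\<eta> * b) ^ m)"
      using nz by (simp add: field_simps)
    then show ?thesis by (simp add: k F_fps_def f_def d_def fk_def dk_def fm_def)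
  qed
qed

lemma kernel_fps_nth_Suc_index: "kernel_fps (Suc n) $ j = of_nat (Suc j) * kernel_fps n $ Suc j"
  by (simp add: kernel_fps_nth field_simps del: of_nat_Suc)

text \<open>
  The rational function is \<open>j + n - 1 + 4 / (j + n + 3)\<close>, an affine function plus a strictly convex one.
\<close>
lemma ratio_not_affine:
  assumes "r = (\<lambda>j. (real j + real n + 1)\<^sup>2 / (real j + real n + 3))"
  shows "2 * r 1 \<noteq> r 0 + r 2"
proof -
  have "r j = real j + real n - 1 + 4 / (real j + real n + 3)" for j
    by (simp add: assms field_simps power2_eq_square)
  from this[of 0] this[of 1] this[of 2]
  have "r 0 + r 2 - 2 * r 1 = 4 * (1 / (real n + 3) + 1 / (real n + 5) - 2 / (real n + 4))"
    by (simp add: add_ac)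
  also have "\<dots> = 8 / ((real n + 3) * (real n + 4) * (real n + 5))"
    by (simp add: divide_simps) (simp add: algebra_simps)
  also have "\<dots> > 0" by simp
  finally show ?thesis by simp
qed

text \<open>
  After the substitution \<open>\<Phi> = b + h\<close>, both sides of the symmetry relation between \<open>n + 2\<close> and \<open>n + 3\<close> are polynomials in \<open>b\<close>
  whose coefficients are known. The terms without a factor \<open>c\<close> agree, and so do those linear in \<open>c\<close>. Only the
  terms with \<open>c\<^sup>2\<close> remain, and they say that three quotients of consecutive coefficients of \<open>F\<^sub>1\<close>, suitably normalized,
  are in arithmetic progression.
\<close>
lemma product_zero: "a * b * c = 0"
proof (rule ccontr)
  assume "a * b * c \<noteq> 0"
  then have nz: "a \<noteq> 0" "b \<noteq> 0" "c \<noteq> 0" by auto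
  define \<beta> where "\<beta> = \<eta> * b"
  have "\<beta> \<noteq> 0" using nz eta by (simp add: \<beta>_def)
  define K where "K j = kernel_fps n $ j" for j
  have K: "K j \<noteq> 0" for j by (simp add: K_def kernel_fps_nonzero)
  have p_K: "p $ j = a / K 0 * K j * \<beta> ^ j" for j
    by (simp only: p_nth[of j] K_def \<beta>_def)
  have h_0: "h $ 0 = 0" and h_1: "h $ Suc 0 = c" by (simp_all add: h_def b_def c_def)
  have q: "(p * h) $ Suc j = a * c / K 1 * (of_nat (Suc j) * K (Suc j)) * \<beta> ^ j" for j
  proof -
    have "(p * h) $ Suc j = (\<Psi> * h) $ (j + Suc n)"
      using Psi_mult_nth[of h "Suc j"] by (simp add: add.commute)
    also have "\<dots> = a * c / kernel_fps (Suc n) $ 0 * kernel_fps (Suc n) $ j * \<beta> ^ j"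
      unfolding Psi_h_formula Suc_eq_plus1[symmetric] fps_mult_left_const_nth F_fps_nth_add
      by (simp add: kernel_fps_nth \<beta>_def)
    finally show ?thesis by (simp add: kernel_fps_nth_Suc_index K_def)
  qed
  have q_0: "(p * h) $ 0 = 0" by (simp add: h_0)
  \<comment> \<open>solve \<open>p h\<close>, which is known, for the second coefficient of \<open>h\<close>\<close>
  have h_2: "h $ 2 = c * \<beta> * (2 * K 2 / K 1 - K 1 / K 0)"
  proof -
    have "a * h $ 2 = (p * h) $ 2 - p $ 1 * c"
      by (simp add: fps_mult_nth numeral_2_eq_2 h_0 h_1 p_0)
    also have "\<dots> = a * (c * \<beta> * (2 * K 2 / K 1 - K 1 / K 0))"
      using q[of 1] K[of 0] K[of "Suc 0"] by (simp add: p_K numeral_2_eq_2 field_simps)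
    finally show ?thesis using nz by simp
  qed
  have q_1: "(p * h) $ 1 = a * c" using q[of 0] K[of 1] by simp
  have q_2: "(p * h) $ 2 = a * c * \<beta> * (2 * K 2 / K 1)"
    using q[of 1] by (simp add: numeral_2_eq_2)
  have q_3: "(p * h) $ 3 = a * c * \<beta>\<^sup>2 * (3 * K 3 / K 1)"
    using q[of 2] by (simp add: numeral_3_eq_3)
  have mult_2: "(A * B) $ 2 = A $ 0 * B $ 2 + A $ 1 * B $ 1 + A $ 2 * B $ 0"
    and mult_3: "(A * B) $ 3 = A $ 0 * B $ 3 + A $ 1 * B $ 2 + A $ 2 * B $ 1 + A $ 3 * B $ 0"
    and mult_1: "(A * B) $ 1 = A $ 0 * B $ 1 + A $ 1 * B $ 0"
    for A B :: "complex fps"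
    by (simp_all add: fps_mult_nth numeral_2_eq_2 numeral_3_eq_3)
  have h_1': "h $ 1 = c" using h_1 by simp
  have hh_2: "(p * h * h) $ 2 = a * c\<^sup>2"
    unfolding mult_2[of "p * h"] q_0 q_1 q_2 h_0 h_1' by (simp add: power2_eq_square)
  have hh_3: "(p * h * h) $ 3 = a * c\<^sup>2 * \<beta> * (4 * K 2 / K 1 - K 1 / K 0)"
    unfolding mult_3[of "p * h"] q_0 q_1 q_2 q_3 h_0 h_1' h_2 by (simp add: power2_eq_square algebra_simps)
  have hhh_2: "(p * h * h * h) $ 2 = 0"
    unfolding mult_2[of "p * h * h"] mult_1[of "p * h"] h_0 q_0 by (simp add: h_0)
  \<comment> \<open>the symmetry relation between \<open>n + 2\<close> and \<open>n + 3\<close>\<close>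
  have entry: "K 2 * (p * \<Phi>\<^sup>2) $ 3 = \<eta> * (K 3 * (p * \<Phi> ^ 3) $ 2)"
  proof -
    have 2: "fact (n + 2) / 2 * delta (n + 2) = K 2" and 3: "fact (n + 3) / 6 * delta (n + 3) = K 3"
      by (simp_all add: K_def kernel_fps_nth add.commute fact_numeral)
    have e: "comp_diff_entry n \<Psi> \<Phi> (n + 3) (n + 2) = fact (n + 2) / 2 * (p * \<Phi>\<^sup>2) $ 3"
      "comp_diff_entry n \<Psi> \<Phi> (n + 2) (n + 3) = fact (n + 3) / 6 * (p * \<Phi> ^ 3) $ 2"
      unfolding Psi_mult_nth[symmetric] by (simp_all add: comp_diff_entry_def fact_numeral)
    have "\<eta> ^ (n + 2) * (K 2 * (p * \<Phi>\<^sup>2) $ 3) = \<eta> ^ (n + 2) * (\<eta> * (K 3 * (p * \<Phi> ^ 3) $ 2))"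
      using sym[of "n + 2" "n + 3"] unfolding e 2[symmetric] 3[symmetric]
      by (simp add: power_add numeral_3_eq_3 numeral_2_eq_2 mult_ac)
    then show ?thesis using eta by simp
  qed
  have Phi: "\<Phi> = fps_const b + h" by (simp add: h_def)
  have "(p * \<Phi>\<^sup>2) $ 3 = b\<^sup>2 * p $ 3 + 2 * b * (p * h) $ 3 + (p * h * h) $ 3"
  proof -
    have "P * (fps_const x + H)\<^sup>2 = fps_const (x\<^sup>2) * P + fps_const (2 * x) * (P * H) + P * H * H"
      for x and P H :: "complex fps"
      by (simp add: algebra_simps power2_eq_square numeral_fps_const flip: fps_const_mult)
    from this[of p b h] show ?thesis unfolding Phi[symmetric] by simp
  qed
  also have "\<dots> = a * (b\<^sup>2 * \<beta> ^ 3 * (K 3 / K 0) + 2 * b * c * \<beta>\<^sup>2 * (3 * K 3 / K 1)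
      + c\<^sup>2 * \<beta> * (4 * K 2 / K 1 - K 1 / K 0))"
    unfolding hh_3 q_3 p_K by (simp add: algebra_simps)
  finally have left: "(p * \<Phi>\<^sup>2) $ 3 = \<dots>" .
  have "(p * \<Phi> ^ 3) $ 2 = b ^ 3 * p $ 2 + 3 * b\<^sup>2 * (p * h) $ 2 + 3 * b * (p * h * h) $ 2 + (p * h * h * h) $ 2"
  proof -
    have "P * (fps_const x + H) ^ 3 = fps_const (x ^ 3) * P + fps_const (3 * x\<^sup>2) * (P * H)
            + fps_const (3 * x) * (P * H * H) + P * H * H * H"
      for x and P H :: "complex fps"
    proof -
      have "P * (X + H) ^ 3 = X ^ 3 * P + 3 * X\<^sup>2 * (P * H) + 3 * X * (P * H * H) + P * H * H * H" for X
        by (simp add: algebra_simps power2_eq_square power3_eq_cube)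
      then show ?thesis
        by (simp add: numeral_fps_const fps_const_power flip: fps_const_mult)
    qed
    from this[of p b h] show ?thesis unfolding Phi[symmetric] by simp
  qed
  also have "\<dots> = a * b * (b\<^sup>2 * \<beta>\<^sup>2 * (K 2 / K 0) + 3 * b * c * \<beta> * (2 * K 2 / K 1) + 3 * c\<^sup>2)"
    unfolding hhh_2 hh_2 q_2 p_K by (simp add: algebra_simps power2_eq_square power3_eq_cube)
  finally have right: "\<eta> * (K 3 * (p * \<Phi> ^ 3) $ 2)
      = K 3 * a * \<beta> * (b\<^sup>2 * \<beta>\<^sup>2 * (K 2 / K 0) + 3 * b * c * \<beta> * (2 * K 2 / K 1) + 3 * c\<^sup>2)"
    by (simp add: \<beta>_def)
  have "a * c\<^sup>2 * \<beta> * (K 2 * (4 * K 2 / K 1 - K 1 / K 0)) = a * c\<^sup>2 * \<beta> * (3 * K 3)"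
    using entry unfolding left right by (simp add: algebra_simps power2_eq_square power3_eq_cube)
  then have rel: "K 2 * (4 * K 2 / K 1 - K 1 / K 0) = 3 * K 3"
    using nz \<open>\<beta> \<noteq> 0\<close> by simp
  define r where "r = (\<lambda>j. (real j + real n + 1)\<^sup>2 / (real j + real n + 3))"
  have step: "of_nat (Suc j) * K (Suc j) = of_real (r j) * K j" for j
  proof -
    have "of_nat (Suc j) * K (Suc j) = (of_nat (Suc (j + n)))\<^sup>2 / of_nat (j + n + 3) * K j"
      using kernel_fps_Suc_of_nat[of j n] unfolding K_def
      by (simp add: field_simps del: of_nat_Suc of_nat_add)
    also have "(of_nat (Suc (j + n)))\<^sup>2 / of_nat (j + n + 3) = (of_real (r j) :: complex)"
      by (simp add: r_def add_ac)
    finally show ?thesis .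
  qed
  have K1: "K 1 = of_real (r 0) * K 0" and K2: "2 * K 2 = of_real (r 1) * K 1"
    and K3: "3 * K 3 = of_real (r 2) * K 2"
    using step[of 0] step[of 1] step[of 2] by (simp_all add: numeral_2_eq_2 numeral_3_eq_3)
  have "4 * K 2 / K 1 = 2 * of_real (r 1)" "K 1 / K 0 = of_real (r 0)"
    using K1 K2 K[of 0] K[of 1] by (simp_all add: field_simps)
  with rel K3 K[of 2] have "of_real (2 * r 1 - r 0) = (of_real (r 2) :: complex)"
    by (simp add: mult.commute)
  then have "2 * r 1 - r 0 = r 2" by (simp only: of_real_eq_iff)
  then show False using ratio_not_affine[OF r_def] by simp
qed

end

section \<open>Zeros of the first series\<close>

text \<open>
  The Enestrom-Kakeya argument: if the sum were \<open>0\<close>, then multiplying by \<open>1 - w\<close> would give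
  \<open>d\<^sub>0 = \<Sum> (d\<^sub>j - d\<^sub>j\<^sub>+\<^sub>1) w\<^bsup>j + 1\<^esup>\<close>, but the right hand side is at most \<open>|w| d\<^sub>0\<close> in absolute value by telescoping.
\<close>
lemma antimono_power_series_nonzero:
  fixes d :: "nat \<Rightarrow> real" and w :: complex
  assumes "antimono d" and "\<And>j. 0 \<le> d j" and "0 < d 0" and "cmod w < 1"
    and "(\<lambda>j. of_real (d j) * w ^ j) sums s"
  shows "s \<noteq> 0"
proof
  assume "s = 0"
  define p where "p j = of_real (d j - d (Suc j)) * w ^ Suc j" for j
  have tail: "(\<lambda>j. of_real (d (Suc j)) * w ^ Suc j) sums (s - of_real (d 0))"
    using assms(5) by (subst sums_Suc_iff) simp
  have p_sums: "p sums of_real (d 0)"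
    using sums_diff[OF sums_mult[OF assms(5), of w] tail] \<open>s = 0\<close>
    by (simp add: p_def[abs_def] algebra_simps)
  have bound: "cmod (\<Sum>j<N. p j) \<le> cmod w * d 0" for N
  proof -
    have "cmod (p j) \<le> cmod w * (d j - d (Suc j))" for j
    proof -
      have "cmod (p j) = (d j - d (Suc j)) * cmod w ^ j * cmod w"
        using antimonoD[OF assms(1), of j "Suc j"]
        unfolding p_def by (simp add: norm_mult norm_power del: of_real_diff)
      also have "\<dots> \<le> (d j - d (Suc j)) * 1 * cmod w"
        using antimonoD[OF assms(1), of j "Suc j"] assms(4)
        by (intro mult_right_mono mult_left_mono power_le_one) auto
      finally show ?thesis by (simp add: mult.commute)
    qed
    then have "cmod (\<Sum>j<N. p j) \<le> (\<Sum>j<N. cmod w * (d j - d (Suc j)))"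
      by (rule sum_norm_le)
    also have "\<dots> = cmod w * (d 0 - d N)"
      by (simp add: sum_lessThan_telescope' flip: sum_distrib_left)
    also have "\<dots> \<le> cmod w * d 0"
      using assms(2)[of N] by (intro mult_left_mono) auto
    finally show ?thesis .
  qed
  have "cmod (of_real (d 0)) \<le> cmod w * d 0"
    using p_sums unfolding sums_def
    by (intro tendsto_upperbound[OF tendsto_norm]) (auto simp: bound)
  then have "d 0 \<le> cmod w * d 0" using assms(3) by simp
  moreover have "cmod w * d 0 < 1 * d 0"
    using assms(3,4) by (intro mult_strict_right_mono)
  ultimately show False by simp
qed

text \<open>
  Gauss' differential equation for equal upper parameters \<open>a, a\<close> and lower parameter \<open>c\<close>. It is the form in
  which the coefficient recurrence can be transported through multiplication by a power of \<open>1 - X\<close>.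
\<close>
lemma hypergeometric_equation_iff:
  fixes a c :: complex and G :: "complex fps"
  shows "fps_X * (1 - fps_X) * fps_deriv (fps_deriv G)
           + (fps_const c - fps_const (2 * a + 1) * fps_X) * fps_deriv G - fps_const (a\<^sup>2) * G = 0
         \<longleftrightarrow> (\<forall>j. (of_nat j + 1) * (of_nat j + c) * G $ Suc j = (of_nat j + a)\<^sup>2 * G $ j)"
    (is "?L = 0 \<longleftrightarrow> _")
proof -
  have L: "?L = fps_X * fps_deriv (fps_deriv G) - fps_X * (fps_X * fps_deriv (fps_deriv G))
     + fps_const c * fps_deriv G - fps_const (2 * a + 1) * (fps_X * fps_deriv G) - fps_const (a\<^sup>2) * G"
    by (simp add: algebra_simps)
  have "?L $ j = (of_nat j + 1) * (of_nat j + c) * G $ Suc j - (of_nat j + a)\<^sup>2 * G $ j" for j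
    unfolding L
    by (cases j; cases "j - 1") (auto simp: algebra_simps power2_eq_square)
  then show ?thesis by (simp add: fps_eq_iff)
qed

text \<open>
  The calculation behind Euler's transformation, with \<open>P, R, S\<close> standing for \<open>(1 - x)\<^sup>m\<close> times a solution and its
  first two derivatives, \<open>P1, P2\<close> for the first two derivatives of \<open>P\<close>, and \<open>R1\<close> for that of \<open>R\<close>.
  The equation for \<open>P\<close> is obtained up to a factor \<open>1 - x\<close>.
\<close>
lemma euler_transformation_algebra:
  fixes x :: "'a::comm_ring_1"
  defines "u \<equiv> 1 - x"
  assumes "m = 2 * a - c"
    and P1: "u * P1 = u * R - m * P"
    and R1: "u * R1 = u * S - m * R"
    and P2: "u * P2 - P1 = u * R1 - R - m * P1"
    and ode: "x * u * S + (c - (2 * a + 1) * x) * R - a\<^sup>2 * P = 0"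
  shows "u * (x * u * P2 + (c - (2 * (c - a) + 1) * x) * P1 - (c - a)\<^sup>2 * P) = 0"
proof -
  have P2': "u * P2 = P1 + u * S - m * R - R - m * P1"
    using P2 unfolding R1 by (simp add: algebra_simps)
  have S: "x * (u * S) = a\<^sup>2 * P - (c - (2 * a + 1) * x) * R"
    using ode by (simp add: algebra_simps)
  have "u * (x * u * P2 + (c - (2 * (c - a) + 1) * x) * P1 - (c - a)\<^sup>2 * P)
      = x * u * (u * P2) + (c - (2 * (c - a) + 1) * x) * (u * P1) - (c - a)\<^sup>2 * u * P"
    by (simp add: algebra_simps)
  also have "\<dots> = x * (1 - m) * (u * P1) + u * (x * (u * S)) - (m + 1) * x * u * R
       + (c - (2 * (c - a) + 1) * x) * (u * P1) - (c - a)\<^sup>2 * u * P"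
    unfolding P2' by (simp add: algebra_simps)
  also have "\<dots> = 0"
    unfolding P1 S by (simp add: u_def assms(2) power2_eq_square algebra_simps)
  finally show ?thesis .
qed

text \<open>
  Euler's transformation \<open>(1 - w)\<^bsup>2 a - c\<^esup> \<^sub>2F\<^sub>1(a, a; c; w) = \<^sub>2F\<^sub>1(c - a, c - a; c; w)\<close> for natural exponents \<open>m = 2 a - c\<close>.
\<close>
lemma euler_transformation:
  fixes a c :: complex and G P :: "complex fps"
  assumes "of_nat m = 2 * a - c" and "P = (1 - fps_X) ^ m * G"
    and "\<And>j. (of_nat j + 1) * (of_nat j + c) * G $ Suc j = (of_nat j + a)\<^sup>2 * G $ j"
  shows "(of_nat j + 1) * (of_nat j + c) * P $ Suc j = (of_nat j + (c - a))\<^sup>2 * P $ j"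
proof -
  let ?u = "1 - fps_X :: complex fps"
  have u: "?u \<noteq> 0"
    by (metis fps_sub_nth fps_one_nth fps_X_nth fps_zero_nth diff_zero zero_neq_one)
  have dm: "?u * fps_deriv (?u ^ m * F) = ?u * (?u ^ m * fps_deriv F) - of_nat m * (?u ^ m * F)" for F
  proof (cases m)
    case (Suc k)
    have "fps_deriv (?u ^ m) = - of_nat m * ?u ^ k"
      using fps_deriv_power'[of ?u m] by (simp add: Suc del: power_Suc of_nat_Suc)
    then have "fps_deriv (?u ^ m * F) = ?u ^ m * fps_deriv F - of_nat m * ?u ^ k * F"
      by simp
    then show ?thesis by (simp only: Suc power_Suc right_diff_distrib mult_ac)
  qed simp
  define R where "R = ?u ^ m * fps_deriv G"
  define S where "S = ?u ^ m * fps_deriv (fps_deriv G)"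
  have P1: "?u * fps_deriv P = ?u * R - of_nat m * P"
    unfolding R_def assms(2) by (rule dm)
  have R1: "?u * fps_deriv R = ?u * S - of_nat m * R"
    unfolding R_def S_def by (rule dm)
  have "fps_deriv (?u * fps_deriv P) = fps_deriv (?u * R - of_nat m * P)" by (simp only: P1)
  then have P2: "?u * fps_deriv (fps_deriv P) - fps_deriv P = ?u * fps_deriv R - R - of_nat m * fps_deriv P"
    by (simp add: algebra_simps)
  let ?a = "fps_const a" and ?c = "fps_const c"
  have mm: "(of_nat m :: complex fps) = 2 * ?a - ?c"
    using assms(1) by (metis fps_const_sub fps_of_nat numeral_fps_const fps_const_mult)
  have ode: "fps_X * ?u * S + (?c - (2 * ?a + 1) * fps_X) * R - ?a\<^sup>2 * P = 0"
  proof -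
    have "fps_X * ?u * fps_deriv (fps_deriv G) + (?c - fps_const (2 * a + 1) * fps_X) * fps_deriv G
            - fps_const (a\<^sup>2) * G = 0"
      using assms(3) hypergeometric_equation_iff by blast
    then have "?u ^ m * (fps_X * ?u * fps_deriv (fps_deriv G)
        + (?c - fps_const (2 * a + 1) * fps_X) * fps_deriv G - fps_const (a\<^sup>2) * G) = 0" by simp
    moreover have "fps_const (2 * a + 1) = 2 * ?a + 1" "fps_const (a\<^sup>2) = ?a\<^sup>2"
      by (simp_all add: numeral_fps_const fps_const_power flip: fps_const_1_eq_1)
    moreover have "U * (x * v * G2 + k * G1 - l * G0) = x * v * (U * G2) + k * (U * G1) - l * (U * G0)"
      for U x v k l G0 G1 G2 :: "complex fps"
      by (simp add: algebra_simps)
    ultimately show ?thesis unfolding R_def S_def assms(2) by (simp only:)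
  qed
  have "?u * (fps_X * ?u * fps_deriv (fps_deriv P)
      + (?c - (2 * (?c - ?a) + 1) * fps_X) * fps_deriv P - (?c - ?a)\<^sup>2 * P) = 0"
    by (rule euler_transformation_algebra[OF mm P1 R1 P2 ode])
  with u have "fps_X * ?u * fps_deriv (fps_deriv P)
      + (?c - (2 * (?c - ?a) + 1) * fps_X) * fps_deriv P - (?c - ?a)\<^sup>2 * P = 0"
    unfolding mult_eq_0_iff by blast
  moreover have "fps_const (2 * (c - a) + 1) = 2 * (?c - ?a) + 1" "fps_const ((c - a)\<^sup>2) = (?c - ?a)\<^sup>2"
    by (simp_all add: numeral_fps_const fps_const_power flip: fps_const_1_eq_1)
  ultimately have "fps_X * ?u * fps_deriv (fps_deriv P)
      + (?c - fps_const (2 * (c - a) + 1) * fps_X) * fps_deriv P - fps_const ((c - a)\<^sup>2) * P = 0"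
    by (simp only:)
  then show ?thesis
    unfolding hypergeometric_equation_iff by blast
qed

lemma kernel_fps_Suc:
  "(of_nat j + 1) * (of_nat j + (of_nat p + 3)) * kernel_fps p $ Suc j
     = (of_nat j + (of_nat p + 1))\<^sup>2 * kernel_fps p $ j"
  using kernel_fps_Suc_of_nat[of j p] by (simp add: add_ac)

lemma kernel_fps_conv_radius: "fps_conv_radius (kernel_fps p) = 1"
  unfolding fps_conv_radius_def
proof (rule conv_radius_ratio_limit_nonzero)
  have "norm (kernel_fps p $ j) / norm (kernel_fps p $ Suc j)
          = (real j + 1) * (real j + real p + 3) / (real j + real p + 1)\<^sup>2" for j
  proof -
    have "real (Suc j) * real (j + p + 3) * norm (kernel_fps p $ Suc j)
        = (real (Suc (j + p)))\<^sup>2 * norm (kernel_fps p $ j)"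
      using arg_cong[OF kernel_fps_Suc_of_nat[of j p], of norm]
      by (simp only: norm_mult norm_power norm_of_nat)
    moreover have "(real j + real p + 1)\<^sup>2 > 0" by simp
    ultimately show ?thesis
      using kernel_fps_nonzero[of p "Suc j"] by (simp add: frac_eq_eq add_ac)
  qed
  moreover have "(\<lambda>j. (real j + 1) * (real j + real p + 3) / (real j + real p + 1)\<^sup>2) \<longlonglongrightarrow> 1"
    by real_asymp
  ultimately show "(\<lambda>j. norm (kernel_fps p $ j) / norm (kernel_fps p $ Suc j)) \<longlonglongrightarrow> 1"
    by simp
qed (simp_all add: one_ereal_def)

text \<open>
  For \<open>n \<ge> 2\<close> the coefficients of this series increase. Multiplication by \<open>(1 - w)\<^bsup>n - 1\<^esup>\<close> turns it into a
  multiple of \<open>\<^sub>2F\<^sub>1(2, 2; n + 3; w)\<close>, whose coefficients are positive and do not increase because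
  \<open>(j + 2)\<^sup>2 \<le> (j + 1) (j + n + 3)\<close> for \<open>n \<ge> 1\<close>.
\<close>
lemma eval_kernel_fps_nonzero:
  assumes "n \<ge> 1" and "cmod w < 1"
  shows "eval_fps (kernel_fps n) w \<noteq> 0"
proof -
  define u :: "complex fps" where "u = (1 - fps_X) ^ (n - 1)"
  define P where "P = u * kernel_fps n"
  have P_Suc: "(of_nat j + 1) * (of_nat j + (of_nat n + 3)) * P $ Suc j = (of_nat j + 2)\<^sup>2 * P $ j" for j
  proof -
    have "of_nat (n - 1) = 2 * (of_nat n + 1) - (of_nat n + 3 :: complex)"
      using assms(1) by (simp add: of_nat_diff)
    from euler_transformation[OF this P_def[unfolded u_def] kernel_fps_Suc, of j] show ?thesis by simp
  qed
  define d where "d j = Re (P $ j)" for j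
  have P_real: "P $ j = of_real (d j) \<and> d j > 0" for j
  proof (induction j)
    case 0
    have "P $ 0 = of_real (fact n * (2 / ((real n + 1) * (real n + 2))))"
      by (simp add: P_def u_def fps_power_zeroth kernel_fps_nth delta_def)
    then show ?case by (simp add: d_def)
  next
    case (Suc j)
    define q where "q = (real j + 2)\<^sup>2 / ((real j + 1) * (real j + real n + 3))"
    have "of_real ((real j + 1) * (real j + real n + 3)) * P $ Suc j = of_real ((real j + 2)\<^sup>2) * P $ j"
      using P_Suc[of j] by (simp add: add_ac)
    moreover have "(real j + 1) * (real j + real n + 3) \<noteq> 0" by (simp add: add_nonneg_eq_0_iff)
    ultimately have "P $ Suc j = of_real q * P $ j"
      unfolding q_def of_real_divide by (simp add: eq_divide_eq mult.commute del: of_real_mult of_real_add)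
    with Suc have "P $ Suc j = of_real (q * d j)" by simp
    moreover have "q * d j > 0" using Suc by (simp add: q_def add_pos_nonneg zero_less_power)
    ultimately show ?case by (simp add: d_def)
  qed
  have "d (Suc j) \<le> d j" for j
  proof -
    have "of_real ((real j + 1) * (real j + (real n + 3)) * d (Suc j)) = (of_real ((real j + 2)\<^sup>2 * d j) :: complex)"
      using P_Suc[of j] P_real[of j] P_real[of "Suc j"] by simp
    then have "(real j + 1) * (real j + (real n + 3)) * d (Suc j) = (real j + 2)\<^sup>2 * d j"
      by (simp only: of_real_eq_iff)
    also have "\<dots> \<le> (real j + 1) * (real j + (real n + 3)) * d j"
    proof (rule mult_right_mono)
      have "real j * real n \<ge> 0" "real n \<ge> 1" using assms(1) by auto
      moreover have "(real j + 1) * (real j + (real n + 3)) - (real j + 2)\<^sup>2 = real j * real n + (real n - 1)"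
        by (simp add: power2_eq_square algebra_simps)
      ultimately show "(real j + 2)\<^sup>2 \<le> (real j + 1) * (real j + (real n + 3))" by linarith
    qed (use P_real[of j] in simp)
    finally show ?thesis by (rule mult_left_le_imp_le) simp
  qed
  then have "antimono d" by (simp add: decseq_SucI)
  have u_rad: "fps_conv_radius u = \<infinity>"
  proof -
    have "fps_conv_radius (1 - fps_X :: complex fps) = \<infinity>"
      using fps_conv_radius_diff[of "1 :: complex fps" fps_X] by simp
    then show ?thesis
      using fps_conv_radius_power[of "1 - fps_X :: complex fps" "n - 1"] by (simp add: u_def)
  qed
  have "fps_conv_radius P \<ge> 1"
    using fps_conv_radius_mult[of u "kernel_fps n"] by (simp add: P_def u_rad kernel_fps_conv_radius)
  moreover have "ereal (cmod w) < 1" using assms(2) by simp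
  ultimately have P_rad: "ereal (cmod w) < fps_conv_radius P" by (rule less_le_trans[rotated])
  have "eval_fps P w \<noteq> 0"
    using antimono_power_series_nonzero[OF \<open>antimono d\<close> _ _ assms(2), of "eval_fps P w"]
      sums_eval_fps[OF P_rad] P_real by (simp add: less_imp_le)
  moreover have "eval_fps P w = eval_fps u w * eval_fps (kernel_fps n) w"
    unfolding P_def using assms(2) by (intro eval_fps_mult) (simp_all add: u_rad kernel_fps_conv_radius)
  ultimately show ?thesis by auto
qed

section \<open>From formal identities to the symbols\<close>

lemma F_term_eq: "F_term p \<beta> (j + p) z = z ^ p * (kernel_fps p $ j * (\<beta> * z) ^ j)"
  by (simp add: F_term_def kernel_fps_nth power_mult_distrib power_add)

lemma F_fps_sums:
  assumes "summable (\<lambda>j. F_term p \<beta> (j + p) z)"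
  shows "(\<lambda>k. F_fps p \<beta> $ k * z ^ k) sums F_series p \<beta> z"
proof -
  have "(\<lambda>j. F_fps p \<beta> $ (j + p) * z ^ (j + p)) sums F_series p \<beta> z"
    using summable_sums[OF assms]
    by (simp add: F_series_def F_term_eq F_fps_nth_add power_add power_mult_distrib mult_ac)
  then show ?thesis by (subst (asm) sums_zero_iff_shift) (simp_all add: F_fps_nth_less)
qed

lemma F_term_sums:
  assumes "cmod (\<beta> * z) < 1"
  shows "(\<lambda>j. F_term p \<beta> (j + p) z) sums (z ^ p * eval_fps (kernel_fps p) (\<beta> * z))"
  unfolding F_term_eq
  by (intro sums_mult sums_eval_fps) (use assms in \<open>simp add: kernel_fps_conv_radius\<close>)

lemma F_series_eq:
  assumes "cmod (\<beta> * z) < 1"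
  shows "F_series p \<beta> z = z ^ p * eval_fps (kernel_fps p) (\<beta> * z)"
  using F_term_sums[OF assms] by (simp add: F_series_def sums_iff)

lemma norm_mult_less_1:
  fixes z w :: complex
  assumes "cmod z < 1" and "cmod w < 1"
  shows "cmod (z * w) < 1"
  using mult_strict_mono'[OF assms] by (simp add: norm_mult)

text \<open>
  The factor \<open>z\<close> is \<open>z\<^bsup>n + 1\<^esup> / z\<^sup>n\<close>, and the denominator has no zero in the disc. So the right hand side is
  analytic on the whole disc and fills in the singularity of the quotient at \<open>0\<close>.
\<close>
lemma F_ratio_eq:
  assumes "n \<ge> 1" and "cmod \<beta> < 1" and "z \<in> unit_disc"
  shows "F_ratio n \<beta> z = z * eval_fps (kernel_fps (n + 1)) (\<beta> * z) / eval_fps (kernel_fps n) (\<beta> * z)"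
    (is "_ = ?R z")
    and "F_ratio n \<beta> holomorphic_on unit_disc"
proof -
  have disc: "cmod (\<beta> * w) < 1" if "w \<in> unit_disc" for w
    using that assms(2) by (simp add: norm_mult_less_1)
  have eval_hol: "(\<lambda>w. eval_fps (kernel_fps p) (\<beta> * w)) holomorphic_on unit_disc" for p
  proof (rule holomorphic_on_compose[of "\<lambda>w. \<beta> * w" _ "eval_fps (kernel_fps p)", unfolded o_def])
    show "eval_fps (kernel_fps p) holomorphic_on (*) \<beta> ` unit_disc"
      using disc by (intro holomorphic_on_eval_fps) (auto simp: kernel_fps_conv_radius in_eball_iff)
  qed (intro holomorphic_intros)
  have R_hol: "?R holomorphic_on unit_disc"
    by (intro holomorphic_intros eval_hol) (use disc eval_kernel_fps_nonzero[OF assms(1)] in blast)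
  have eq: "F_ratio n \<beta> w = ?R w" if w: "w \<in> unit_disc" for w
  proof -
    have "eventually (\<lambda>z. z \<in> unit_disc - {0}) (at w)"
    proof (cases "w = 0")
      case True
      then show ?thesis using eventually_at_in_open[of unit_disc w] by simp
    next
      case False
      then show ?thesis using w by (intro eventually_at_in_open') (auto simp: open_delete)
    qed
    then have "eventually (\<lambda>z. F_series (n + 1) \<beta> z / F_series n \<beta> z = ?R z) (at w)"
      by (rule eventually_mono) (use disc in \<open>simp add: F_series_eq\<close>)
    then have "F_ratio n \<beta> w = remove_sings ?R w"
      unfolding F_ratio_def by (rule remove_sings_cong) simp
    also have "\<dots> = ?R w"
      using R_hol w by (intro remove_sings_at_analytic) (auto simp: analytic_on_open intro: analytic_on_subset[of _ unit_disc])
    finally show ?thesis .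
  qed
  show "F_ratio n \<beta> z = ?R z" by (rule eq[OF assms(3)])
  show "F_ratio n \<beta> holomorphic_on unit_disc"
    by (rule holomorphic_transform[OF R_hol]) (simp add: eq)
qed

lemma kernel_fps_ratio_0: "kernel_fps n $ 0 / kernel_fps (n + 1) $ 0 = (of_nat n + 3) / (of_nat n + 1)\<^sup>2"
proof -
  have "kernel_fps (n + 1) $ 0 = kernel_fps n $ 1"
    by (simp add: kernel_fps_nth)
  moreover have "of_nat (n + 3) * kernel_fps n $ 1 = (of_nat (Suc n))\<^sup>2 * kernel_fps n $ 0"
    using kernel_fps_Suc_of_nat[of 0 n] by simp
  ultimately have "kernel_fps n $ 0 / kernel_fps (n + 1) $ 0 = of_nat (n + 3) / (of_nat (Suc n))\<^sup>2"
    using kernel_fps_nonzero[of "n + 1" 0]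
    by (simp add: frac_eq_eq mult.commute del: of_nat_Suc of_nat_add)
  then show ?thesis by (simp add: add.commute)
qed

lemma kernel_fps_nth_0: "kernel_fps p $ 0 = fact p * delta p"
  by (simp add: kernel_fps_nth)

lemma series_of_fps_multiple:
  assumes "f holomorphic_on unit_disc" and "f has_fps_expansion fps_const C * F_fps p \<beta>"
    and "z \<in> unit_disc" and "summable (\<lambda>j. F_term p \<beta> (j + p) z)"
  shows "f z = C * F_series p \<beta> z"
proof -
  have "(\<lambda>k. C * (F_fps p \<beta> $ k * z ^ k)) sums f z"
    using disc_sums[OF assms(1,3)] by (simp add: taylor_coeff_eq_fps_nth[OF assms(2)] mult.assoc)
  then show ?thesis
    using sums_mult[OF F_fps_sums[OF assms(4)], of C] sums_unique2 by blast
qed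

text \<open>
  The formal identities become identities of functions on the disc, since \<open>|\<eta> b| = |\<phi>(0)| < 1\<close> makes the series converge
  there. Away from \<open>0\<close> one may then divide by \<open>\<psi>\<close>; at \<open>0\<close> the ratio vanishes and \<open>\<phi>(0) = b\<close>.
\<close>
lemma symbol_conditionI:
  assumes "n \<ge> 1" and "cmod \<eta> = 1"
    and phi: "\<phi> holomorphic_on unit_disc" "\<phi> ` unit_disc \<subseteq> unit_disc"
    and psi: "\<psi> holomorphic_on unit_disc" "\<exists>z\<in>unit_disc. \<psi> z \<noteq> 0"
    and "symmetric_entries n \<eta> (fps_expansion \<psi> 0) (fps_expansion \<phi> 0)"
  shows "\<exists>a b c. symbol_condition n \<eta> \<psi> \<phi> a b c"
proof -
  interpret symmetric_entries n \<eta> "fps_expansion \<psi> 0" "fps_expansion \<phi> 0" by fact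
  define \<beta> where "\<beta> = \<eta> * b"
  have e: "\<psi> has_fps_expansion fps_expansion \<psi> 0" "\<phi> has_fps_expansion fps_expansion \<phi> 0"
    using phi psi by (auto intro!: has_fps_expansion_fps_expansion[of unit_disc])
  have b: "b = \<phi> 0"
    unfolding b_def by (simp add: fps_expansion_def)
  have "cmod \<beta> < 1"
    using phi(2) by (auto simp: \<beta>_def b norm_mult image_subset_iff \<open>cmod \<eta> = 1\<close>)
  then have disc: "cmod (\<beta> * z) < 1" if "z \<in> unit_disc" for z
    using that by (simp add: norm_mult_less_1)
  have summ: "summable (\<lambda>j. F_term p \<beta> (j + p) z)" if "z \<in> unit_disc" for p z
    using F_term_sums[OF disc[OF that]] by (rule sums_summable)
  have psi_eq: "\<psi> z = a / (fact n * delta n) * F_series n \<beta> z" if "z \<in> unit_disc" for z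
    by (rule series_of_fps_multiple[OF psi(1) _ that summ[OF that]])
       (use e(1) Psi_formula in \<open>simp add: \<beta>_def\<close>)
  with psi(2) have "a \<noteq> 0" by auto
  have product_eq: "\<psi> z * (\<phi> z - b) = a * c / (fact (n + 1) * delta (n + 1)) * F_series (n + 1) \<beta> z"
    if "z \<in> unit_disc" for z
  proof (rule series_of_fps_multiple[OF _ _ that summ[OF that]])
    show "(\<lambda>z. \<psi> z * (\<phi> z - b)) holomorphic_on unit_disc"
      by (intro holomorphic_intros phi psi)
    have "(\<lambda>z. \<psi> z * (\<phi> z - b)) has_fps_expansion fps_expansion \<psi> 0 * h"
      unfolding h_def by (intro fps_expansion_intros e)
    then show "(\<lambda>z. \<psi> z * (\<phi> z - b)) has_fps_expansion
        fps_const (a * c / (fact (n + 1) * delta (n + 1))) * F_fps (n + 1) \<beta>"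
      unfolding Psi_h_formula \<beta>_def .
  qed
  have phi_eq: "\<phi> z = b + c * ((of_nat n + 3) / (of_nat n + 1)\<^sup>2) * F_ratio n \<beta> z"
    if z: "z \<in> unit_disc" for z
  proof (cases "z = 0")
    case True
    then show ?thesis using F_ratio_eq(1)[OF assms(1) \<open>cmod \<beta> < 1\<close> z] by (simp add: b)
  next
    case False
    define K K' E E' where "K = kernel_fps n $ 0" and "K' = kernel_fps (n + 1) $ 0"
      and "E = eval_fps (kernel_fps n) (\<beta> * z)" and "E' = eval_fps (kernel_fps (n + 1)) (\<beta> * z)"
    have nz: "K \<noteq> 0" "K' \<noteq> 0" "E \<noteq> 0"
      using kernel_fps_nonzero eval_kernel_fps_nonzero[OF assms(1) disc[OF z]]
      by (auto simp: K_def K'_def E_def)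
    have "a / K * (z ^ n * E) * (\<phi> z - b) = a * c / K' * (z ^ (n + 1) * E')"
      using product_eq[OF z] unfolding psi_eq[OF z] F_series_eq[OF disc[OF z]] kernel_fps_nth_0[symmetric]
        K_def K'_def E_def E'_def .
    then have "(a * z ^ n) * (K' * E * (\<phi> z - b)) = (a * z ^ n) * (K * c * z * E')"
      using nz by (simp add: field_simps)
    then have "K' * E * (\<phi> z - b) = K * c * z * E'"
      using \<open>a \<noteq> 0\<close> False by simp
    then have "\<phi> z - b = c * (K / K') * (z * E' / E)"
      using nz by (simp add: field_simps)
    then show ?thesis
      using F_ratio_eq(1)[OF assms(1) \<open>cmod \<beta> < 1\<close> z]
      unfolding K_def K'_def E_def E'_def kernel_fps_ratio_0 by (simp add: algebra_simps)
  qed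
  have "symbol_condition n \<eta> \<psi> \<phi> a b c"
    unfolding symbol_condition_def \<beta>_def[symmetric]
    by (intro conjI ballI summ psi_eq phi_eq F_ratio_eq(2)[OF assms(1) \<open>cmod \<beta> < 1\<close>, of 0]) simp_all
  then show ?thesis by blast
qed

text \<open>
  The constants of the given representation coincide with \<open>b = \<phi>(0)\<close> and \<open>c = \<phi>'(0)\<close>, to which \<open>product_zero\<close> applies.
  For this the ratio \<open>F\<^sub>2 / F\<^sub>1\<close> is expanded at \<open>0\<close> up to first order; \<open>b'\<close> is an arbitrary complex number at this point,
  so the quotient is controlled near \<open>0\<close> through the isolation of the zeros of \<open>F\<^sub>1\<close>.
\<close>
lemma symbol_condition_imp_zero:
  assumes "n \<ge> 1"
    and phi: "\<phi> holomorphic_on unit_disc"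
    and psi: "\<psi> holomorphic_on unit_disc" "\<exists>z\<in>unit_disc. \<psi> z \<noteq> 0"
    and "symmetric_entries n \<eta> (fps_expansion \<psi> 0) (fps_expansion \<phi> 0)"
    and cond: "symbol_condition n \<eta> \<psi> \<phi> a' b' c'"
  shows "b' = 0 \<or> c' = 0"
proof -
  interpret symmetric_entries n \<eta> "fps_expansion \<psi> 0" "fps_expansion \<phi> 0" by fact
  define \<beta> where "\<beta> = \<eta> * b'"
  define \<gamma> where "\<gamma> = c' * ((of_nat n + 3) / (of_nat n + 1)\<^sup>2 :: complex)"
  have summ: "summable (\<lambda>j. F_term n \<beta> (j + n) z)" "summable (\<lambda>j. F_term (n + 1) \<beta> (j + (n + 1)) z)"
    and psi_eq: "\<psi> z = a' / (fact n * delta n) * F_series n \<beta> z"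
    and phi_eq: "\<phi> z = b' + \<gamma> * F_ratio n \<beta> z"
    if "z \<in> unit_disc" for z
    using cond that unfolding symbol_condition_def \<beta>_def \<gamma>_def by blast+
  have ratio_hol: "F_ratio n \<beta> holomorphic_on unit_disc"
    using cond unfolding symbol_condition_def \<beta>_def by blast
  have F_sums: "(\<lambda>k. F_fps n \<beta> $ k * z ^ k) sums F_series n \<beta> z"
    "(\<lambda>k. F_fps (n + 1) \<beta> $ k * z ^ k) sums F_series (n + 1) \<beta> z" if "z \<in> unit_disc" for z
    by (intro F_fps_sums summ that)+
  have F_hol: "F_series n \<beta> holomorphic_on unit_disc" "F_series (n + 1) \<beta> holomorphic_on unit_disc"
    by (rule disc_series_holomorphic[OF F_sums(1)], assumption, rule disc_series_holomorphic[OF F_sums(2)])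
  have F_exp: "F_series n \<beta> has_fps_expansion F_fps n \<beta>" "F_series (n + 1) \<beta> has_fps_expansion F_fps (n + 1) \<beta>"
    using disc_series_has_fps_expansion[OF F_sums(1)] disc_series_has_fps_expansion[OF F_sums(2)]
    by (simp_all add: fps_nth_inverse)
  obtain z0 where z0: "z0 \<in> unit_disc" "F_series n \<beta> z0 \<noteq> 0"
    using psi(2) psi_eq by auto
  define R where "R = fps_expansion (F_ratio n \<beta>) 0"
  have R_exp: "F_ratio n \<beta> has_fps_expansion R"
    unfolding R_def by (rule has_fps_expansion_fps_expansion[OF _ _ ratio_hol]) auto
  have "eventually (\<lambda>z. F_ratio n \<beta> z * F_series n \<beta> z = F_series (n + 1) \<beta> z) (at 0)"
  proof (rule eventually_mono)
    show "eventually (\<lambda>z. F_series n \<beta> z \<noteq> 0 \<and> z \<in> unit_disc) (at 0)"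
      by (rule non_zero_neighbour_alt[OF F_hol(1) _ _ _ z0]) auto
    fix z assume z: "F_series n \<beta> z \<noteq> 0 \<and> z \<in> unit_disc"
    have "F_series n \<beta> analytic_on {z}" "F_series (n + 1) \<beta> analytic_on {z}"
      using F_hol z by (auto simp: analytic_on_open intro: analytic_on_subset[of _ unit_disc])
    then have "(\<lambda>z. F_series (n + 1) \<beta> z / F_series n \<beta> z) analytic_on {z}"
      using z by (intro analytic_intros) auto
    then show "F_ratio n \<beta> z * F_series n \<beta> z = F_series (n + 1) \<beta> z"
      unfolding F_ratio_def using z by simp
  qed
  moreover have "F_ratio n \<beta> 0 * F_series n \<beta> 0 = F_series (n + 1) \<beta> 0"
    using assms(1) F_series_eq[of \<beta> 0] by simp
  ultimately have "eventually (\<lambda>z. F_ratio n \<beta> z * F_series n \<beta> z = F_series (n + 1) \<beta> z) (nhds 0)"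
    by (simp add: eventually_nhds_conv_at)
  moreover have "(\<lambda>z. F_ratio n \<beta> z * F_series n \<beta> z) has_fps_expansion R * F_fps n \<beta>"
    by (intro fps_expansion_intros R_exp F_exp)
  ultimately have "F_series (n + 1) \<beta> has_fps_expansion R * F_fps n \<beta>"
    by (subst (asm) has_fps_expansion_cong[OF _ refl])
  \<comment> \<open>the product relation \<open>(F\<^sub>2 / F\<^sub>1) F\<^sub>1 = F\<^sub>2\<close> holds near \<open>0\<close>, hence for the expansions\<close>
  then have R: "R * F_fps n \<beta> = F_fps (n + 1) \<beta>"
    using F_exp(2) fps_expansion_unique_complex by blast
  define Q where "Q = fps_shift n (F_fps n \<beta>)"
  have "F_fps n \<beta> = fps_X ^ n * Q"
    by (auto simp: fps_eq_iff Q_def fps_X_power_mult_nth F_fps_nth_less)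
  with R have RQ: "fps_X ^ n * (R * Q) = F_fps (n + 1) \<beta>" by (simp add: mult.left_commute)
  have Q0: "Q $ 0 = kernel_fps n $ 0"
    using F_fps_nth_add[of n \<beta> 0] by (simp add: Q_def)
  have "(R * Q) $ 0 = 0"
    using arg_cong[OF RQ, of "\<lambda>F. F $ n"] by (simp add: fps_X_power_mult_nth F_fps_nth_less)
  then have R0: "R $ 0 = 0" using Q0 kernel_fps_nonzero[of n 0] by simp
  have "(R * Q) $ 1 = kernel_fps (n + 1) $ 0"
    using arg_cong[OF RQ, of "\<lambda>F. F $ (n + 1)"] F_fps_nth_add[of "n + 1" \<beta> 0]
    by (simp add: fps_X_power_mult_nth)
  then have R1: "R $ 1 * kernel_fps n $ 0 = kernel_fps (n + 1) $ 0"
    by (simp add: fps_mult_nth R0 Q0)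
  have "\<phi> has_fps_expansion fps_const b' + fps_const \<gamma> * R"
  proof -
    have "(\<lambda>z. b' + \<gamma> * F_ratio n \<beta> z) has_fps_expansion fps_const b' + fps_const \<gamma> * R"
      by (intro fps_expansion_intros R_exp)
    moreover have "eventually (\<lambda>z. \<phi> z = b' + \<gamma> * F_ratio n \<beta> z) (nhds 0)"
      by (intro eventually_mono[OF eventually_nhds_in_open[of unit_disc 0]]) (auto simp: phi_eq)
    ultimately show ?thesis by (subst has_fps_expansion_cong[OF _ refl])
  qed
  moreover have "\<phi> has_fps_expansion fps_expansion \<phi> 0"
    using phi by (auto intro!: has_fps_expansion_fps_expansion[of unit_disc])
  ultimately have Phi: "fps_expansion \<phi> 0 = fps_const b' + fps_const \<gamma> * R"
    using fps_expansion_unique_complex by blast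
  have b: "b = b'" unfolding b_def by (simp add: Phi R0)
  have c: "c = c'"
  proof -
    have "c = \<gamma> * R $ 1" unfolding c_def by (simp add: Phi)
    also have "\<dots> = c' * ((kernel_fps n $ 0 * R $ 1) / kernel_fps (n + 1) $ 0)"
      by (simp add: \<gamma>_def flip: kernel_fps_ratio_0)
    also have "\<dots> = c'"
      using R1 kernel_fps_nonzero[of "n + 1" 0] by (simp add: mult.commute)
    finally show ?thesis .
  qed
  have "a \<noteq> 0"
  proof
    assume "a = 0"
    then have "fps_expansion \<psi> 0 = 0" using Psi_formula by simp
    then have "taylor_coeff \<psi> m = 0" for m
      by (metis fps_expansion_def fps_nth_Abs_fps fps_zero_nth taylor_coeff_def)
    then have "\<psi> z = 0" if "z \<in> unit_disc" for z
      using disc_sums[OF psi(1) that] by (simp add: sums_iff)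
    with psi(2) show False by blast
  qed
  then show ?thesis using product_zero b c by simp
qed

theorem theorem2p5:
  fixes n :: nat and \<mu> \<eta> :: complex and \<phi> \<psi> :: "complex \<Rightarrow> complex"
  assumes "n \<ge> 1"
    and "cmod \<mu> = 1" and "cmod \<eta> = 1"
    and "\<phi> holomorphic_on unit_disc" and "\<phi> ` unit_disc \<subseteq> unit_disc"
    and "\<psi> holomorphic_on unit_disc"
    and psi_nonzero: "\<exists>z\<in>unit_disc. \<psi> z \<noteq> 0"
    and "S21_bounded (comp_diff n \<psi> \<phi>)"
  shows "(complex_symmetric (comp_diff n \<psi> \<phi>) (conjugation \<mu> \<eta>) \<longrightarrow>
            (\<exists>a b c. symbol_condition n \<eta> \<psi> \<phi> a b c)) \<and>
         (\<forall>a b c. symbol_condition n \<eta> \<psi> \<phi> a b c \<longrightarrow>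
            complex_symmetric (comp_diff n \<psi> \<phi>) (conjugation \<mu> \<eta>) \<longrightarrow>
            b = 0 \<or> c = 0)"
proof -
  have entries: "symmetric_entries n \<eta> (fps_expansion \<psi> 0) (fps_expansion \<phi> 0)"
    if "complex_symmetric (comp_diff n \<psi> \<phi>) (conjugation \<mu> \<eta>)"
  proof
    show "\<eta> \<noteq> 0" using assms(3) by auto
    show "\<eta> ^ j * delta j * comp_diff_entry n (fps_expansion \<psi> 0) (fps_expansion \<phi> 0) k j
        = \<eta> ^ k * delta k * comp_diff_entry n (fps_expansion \<psi> 0) (fps_expansion \<phi> 0) j k" for k j
      using complex_symmetric_entries[OF assms(8) that assms(2,3), of j k]
      unfolding comp_diff_disc_monomial_taylor_coeff[OF assms(4,5,6)] .
  qed
  show ?thesis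
    using symbol_conditionI[OF assms(1,3,4,5,6,7) entries]
      symbol_condition_imp_zero[OF assms(1,4,6,7) entries] by blast
qed

end
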